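(* Let $n\ge 1$, let $\lambda_1,\dots,\lambda_n\in\mathbb{T}$ be pairwise distinct, let $\alpha_1,\dots,\alpha_n>0$, and let $\mu=\sum_{j=1}^n\alpha_j\delta_{\lambda_j}$. A finite positive Borel measure $\nu$ on $\mathbb{D}$ is a Carleson measure for $\mathcal{D}(\mu)$ if and only if the measure $\prod_{j=1}^n|z-\lambda_j|^2\,d\nu(z)$ is a Carleson measure for $H^2$.
   Context: $\mathbb{D}=\{z\in\mathbb{C}:|z|<1\}$ and $\mathbb{T}$ is the unit circle; $\delta_\lambda$ is the unit point mass at $\lambda$. $H^2$ is the Hardy space of analytic functions $f(z)=\sum_{k\ge0}a_kz^k$ on $\mathbb{D}$ with $\|f\|_2^2=\sum_{k\ge0}|a_k|^2<\infty$. For a positive finite Borel measure $\mu$ on $\mathbb{T}$, put $P_\mu(z)=\int_{\mathbb{T}}\frac{1-|z|^2}{|\zeta-z|^2}\,d\mu(\zeta)$ for $z\in\mathbb{D}$. The Dirichlet-type space $\mathcal{D}(\mu)$ is the set of holomorphic functions $f$ on $\mathbb{D}$ with $\mathcal{D}_\mu(f):=\int_{\mathbb{D}}|f'(z)|^2P_\mu(z)\,dA(z)<\infty$, where $dA$ is normalized area measure on $\mathbb{D}$. One has $\mathcal{D}(\mu)\subset H^2$, and $\mathcal{D}(\mu)$ is a Hilbert space with norm $\|f\|_\mu^2=\|f\|_2^2+\mathcal{D}_\mu(f)$. For a Banach space $X$ of holomorphic functions on $\mathbb{D}$, a positive Borel measure $\nu$ on $\mathbb{D}$ is a Carleson measure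 for $X$ if there is a constant $C>0$ with $\int_{\mathbb{D}}|f|^2\,d\nu\le C\|f\|_X^2$ for all $f\in X$ (i.e. the identity map $I:X\to L^2(\nu)$ is bounded). *)

theory Defs
  imports "HOL-Probability.Probability" "HOL-Complex_Analysis.Complex_Analysis"
begin

text \<open>
  Functions on the open unit disc are represented by total functions of type
  \<open>complex \<Rightarrow> complex\<close>; only their values on \<open>ball 0 1\<close> matter.
  Quantities that may be infinite take values in \<^typ>\<open>ennreal\<close>.
\<close>

definition disc_borel :: "complex measure" where
  "disc_borel = restrict_space borel (ball 0 1)"

definition circle_borel :: "complex measure" where
  "circle_borel = restrict_space borel (sphere 0 1)"

definition disc_area :: "complex measure" where
  "disc_area = scale_measure (ennreal (1 / pi)) (restrict_space lborel (ball 0 1))"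

text \<open>The measure $\sum_{j=1}^n \alpha_j \delta_{\lambda_j}$ on the unit circle, with the points $\lambda_j$ given by \<open>l\<close>.\<close>

definition point_mass_sum :: "nat \<Rightarrow> (nat \<Rightarrow> real) \<Rightarrow> (nat \<Rightarrow> complex) \<Rightarrow> complex measure" where
  "point_mass_sum n \<alpha> l = measure_of (space circle_borel) (sets circle_borel)
     (\<lambda>A. \<Sum>j=1..n. ennreal (\<alpha> j) * emeasure (return circle_borel (l j)) A)"

lemma space_point_mass_sum [simp]: "space (point_mass_sum n \<alpha> l) = space circle_borel"
  by (simp add: point_mass_sum_def)

lemma sets_point_mass_sum [simp, measurable_cong]:
  "sets (point_mass_sum n \<alpha> l) = sets circle_borel"
  by (simp add: point_mass_sum_def)

lemma emeasure_point_mass_sum: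
  assumes "A \<in> sets circle_borel"
  shows "emeasure (point_mass_sum n \<alpha> l) A
    = (\<Sum>j=1..n. ennreal (\<alpha> j) * emeasure (return circle_borel (l j)) A)"
proof (rule emeasure_measure_of[OF point_mass_sum_def])
  show "sets circle_borel \<subseteq> Pow (space circle_borel)"
    by (rule sets.space_closed)
  show "A \<in> sets (point_mass_sum n \<alpha> l)"
    using assms by simp
  let ?m = "\<lambda>A. \<Sum>j=1..n. ennreal (\<alpha> j) * emeasure (return circle_borel (l j)) A"
  show "positive (sets (point_mass_sum n \<alpha> l)) ?m"
    by (simp add: positive_def)
  show "countably_additive (sets (point_mass_sum n \<alpha> l)) ?m"
  proof (rule countably_additiveI)
    fix F :: "nat \<Rightarrow> complex set"
    assume F: "range F \<subseteq> sets (point_mass_sum n \<alpha> l)" "disjoint_family F"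
    have "(\<Sum>i. ?m (F i))
        = (\<Sum>j=1..n. \<Sum>i. ennreal (\<alpha> j) * emeasure (return circle_borel (l j)) (F i))"
      by (rule suminf_sum) simp
    also have "\<dots> = (\<Sum>j=1..n. ennreal (\<alpha> j) * emeasure (return circle_borel (l j)) (\<Union>i. F i))"
      using F by (intro sum.cong refl) (simp add: ennreal_suminf_cmult suminf_emeasure del: emeasure_return)
    finally show "(\<Sum>i. ?m (F i)) = ?m (\<Union>i. F i)" .
  qed
qed

definition poisson_integral :: "complex measure \<Rightarrow> complex \<Rightarrow> ennreal" where
  "poisson_integral \<mu> z = (\<integral>\<^sup>+\<zeta>. ennreal ((1 - (cmod z)\<^sup>2) / (cmod (\<zeta> - z))\<^sup>2) \<partial>\<mu>)"

text \<open>The squared norm of $H^2$, in terms of the Taylor coefficients at the origin.\<close>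

definition hardy_norm_sq :: "(complex \<Rightarrow> complex) \<Rightarrow> ennreal" where
  "hardy_norm_sq f = (\<Sum>k. ennreal ((cmod (fps_nth (fps_expansion f 0) k))\<^sup>2))"

definition hardy_space :: "(complex \<Rightarrow> complex) set" where
  "hardy_space = {f. f holomorphic_on ball 0 1 \<and> hardy_norm_sq f < \<infinity>}"

definition dirichlet_integral :: "complex measure \<Rightarrow> (complex \<Rightarrow> complex) \<Rightarrow> ennreal" where
  "dirichlet_integral \<mu> f
     = (\<integral>\<^sup>+z. ennreal ((cmod (deriv f z))\<^sup>2) * poisson_integral \<mu> z \<partial>disc_area)"

definition dirichlet_space :: "complex measure \<Rightarrow> (complex \<Rightarrow> complex) set" where
  "dirichlet_space \<mu> = {f. f holomorphic_on ball 0 1 \<and> dirichlet_integral \<mu> f < \<infinity>}"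

definition dirichlet_norm_sq :: "complex measure \<Rightarrow> (complex \<Rightarrow> complex) \<Rightarrow> ennreal" where
  "dirichlet_norm_sq \<mu> f = hardy_norm_sq f + dirichlet_integral \<mu> f"

text \<open>
  \<open>carleson_measure X N \<nu>\<close>: the measure \<open>\<nu>\<close> on the disc is a Carleson measure for the
  space \<open>X\<close> whose \<^emph>\<open>squared\<close> norm is \<open>N\<close>.
\<close>

definition carleson_measure ::
  "(complex \<Rightarrow> complex) set \<Rightarrow> ((complex \<Rightarrow> complex) \<Rightarrow> ennreal) \<Rightarrow> complex measure \<Rightarrow> bool" where
  "carleson_measure X N \<nu> \<longleftrightarrow>
     (\<exists>C::real. C > 0 \<and> (\<forall>f\<in>X. (\<integral>\<^sup>+z. ennreal ((cmod (f z))\<^sup>2) \<partial>\<nu>) \<le> ennreal C * N f))"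

end

theory Submission
  imports Defs
begin

text \<open>
  Write $D_\lambda(f) = \int |f'|^2 (1-|z|^2)/|z-\lambda|^2\,dA$, so that
  $\mathcal{D}_\mu = \sum_j \alpha_j D_{\lambda_j}$.  Integrating $|F|^2(1-|z|^2)$ over the disc gives
  $\sum_k |c_k|^2/((k+1)(k+2))$ for $F = \sum_k c_k z^k$.  Apply this to $F = f'/(z-\lambda)$.  If
  $f = \beta + (z-\lambda)h$ and $H_k = \lambda^k h_k$ has Cesaro means $\sigma_k$, then
  $|c_k| = (k+1)(k+2)\,|\sigma_{k+1}-\sigma_k|$ and the series telescopes:
  $\sum_{k<K} |c_k|^2/((k+1)(k+2)) = \sum_{k\le K}|H_k|^2 - (K+1)|\sigma_K|^2$.
  Hence $D_\lambda(f) \le \|h\|_2^2$.  Conversely, if $D_\lambda(f) < \infty$ then $\sigma_k$ converges with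
  tails controlled by Cauchy--Schwarz, and choosing $\beta$ so that the limit is $0$ gives
  $\|h\|_2^2 \le D_\lambda(f)$.

  With $p = \prod_j (z-\lambda_j)$ it follows that $pH^2 \subseteq \mathcal{D}(\mu)$ boundedly, and expanding $1/p$
  in partial fractions with coefficients $w_j$ decomposes every $f \in \mathcal{D}(\mu)$ as
  $p \sum_j w_j h_j + \sum_j w_j\beta_j\, p/(z-\lambda_j)$, a multiple of $p$ plus a bounded function, with control of both parts.
\<close>

unbundle no fps_syntax

subsection \<open>Rotation invariance of planar Lebesgue measure\<close>

text \<open>Invariance of Lebesgue measure under orthogonal maps is a statement about
  \<open>real^'n\<close>. The complex plane is identified with \<open>real^2\<close> so that it can
  be applied to multiplication by a unimodular number.\<close>

definition complex_of_vec :: "real^2 \<Rightarrow> complex" where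
  "complex_of_vec x = Complex (x $ 1) (x $ 2)"

definition vec_of_complex :: "complex \<Rightarrow> real^2" where
  "vec_of_complex z = vector [Re z, Im z]"

lemma complex_of_vec_of_complex [simp]: "complex_of_vec (vec_of_complex z) = z"
  by (simp add: complex_of_vec_def vec_of_complex_def)

lemma vec_of_complex_of_vec [simp]: "vec_of_complex (complex_of_vec x) = x"
  by (simp add: complex_of_vec_def vec_of_complex_def vec_eq_iff forall_2)

lemma linear_complex_of_vec: "linear complex_of_vec"
  by (rule linearI) (auto simp: complex_of_vec_def complex_eq_iff)

lemma linear_vec_of_complex: "linear vec_of_complex"
  by (rule linearI) (auto simp: vec_of_complex_def vec_eq_iff forall_2)

lemma norm_vec_of_complex: "norm (vec_of_complex z) = cmod z"
  by (simp add: norm_vec_def L2_set_def sum_2 vec_of_complex_def cmod_def)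

lemma norm_complex_of_vec: "cmod (complex_of_vec x) = norm x"
  by (metis norm_vec_of_complex vec_of_complex_of_vec)

lemma measurable_complex_of_vec [measurable]: "complex_of_vec \<in> borel_measurable borel"
  by (intro borel_measurable_continuous_onI linear_continuous_on)
     (simp add: linear_complex_of_vec linear_conv_bounded_linear[symmetric])

lemma prod_Basis_real2: "(\<Prod>b\<in>Basis. (x :: real^2) \<bullet> b) = x $ 1 * x $ 2"
proof -
  have B: "Basis = {axis 1 1, axis 2 1 :: real^2}"
    by (auto simp: Basis_vec_def UNIV_2)
  have "axis 1 (1::real) \<noteq> (axis 2 1 :: real^2)"
    by (simp add: axis_eq_axis)
  then show ?thesis
    unfolding B by (subst prod.insert) (auto simp: inner_axis)
qed

text \<open>Lebesgue measure is determined by its values on open boxes, and the coordinate map pulls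
  a box back to a box with the same side lengths.\<close>

lemma lborel_complex_of_vec: "distr lborel borel complex_of_vec = lborel"
proof (rule lborel_eqI[symmetric])
  fix l u :: complex
  assume le: "\<And>b. b \<in> Basis \<Longrightarrow> l \<bullet> b \<le> u \<bullet> b"
  have le': "Re l \<le> Re u" "Im l \<le> Im u"
    using le[of 1] le[of \<i>] by (auto simp: Basis_complex_def)
  have vim: "complex_of_vec -` box l u = box (vec_of_complex l) (vec_of_complex u)"
    by (auto simp: complex_of_vec_def vec_of_complex_def mem_box_cart forall_2 in_box_complex_iff)
  have "emeasure (distr lborel borel complex_of_vec) (box l u)
      = emeasure lborel (box (vec_of_complex l) (vec_of_complex u))"
    by (subst emeasure_distr) (simp_all add: vim)
  also have "\<dots> = ennreal ((Re u - Re l) * (Im u - Im l))"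
    using le' by (subst emeasure_lborel_box)
      (auto simp: prod_Basis_real2 vec_of_complex_def, auto simp: Basis_vec_def UNIV_2 inner_axis)
  also have "(Re u - Re l) * (Im u - Im l) = (\<Prod>b\<in>Basis. (u - l) \<bullet> b)"
    by (simp add: Basis_complex_def complex_i_not_one[symmetric])
  finally show "emeasure (distr lborel borel complex_of_vec) (box l u) = (\<Prod>b\<in>Basis. (u - l) \<bullet> b)"
    by simp
qed simp

text \<open>Again only boxes have to be tested. The preimage of a box under the rotation is its
  image under the inverse rotation, and an orthogonal map preserves the measure of that set.\<close>

lemma lborel_distr_complex_rotation:
  fixes w :: complex
  assumes w: "cmod w = 1"
  shows "distr lborel borel ((*) w) = lborel"
proof (rule lborel_eqI[symmetric])
  fix l u :: complex
  assume le: "\<And>b. b \<in> Basis \<Longrightarrow> l \<bullet> b \<le> u \<bullet> b"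
  \<comment> \<open>Since |w| = 1, multiplication by \<open>cnj w\<close> inverts multiplication by
    \<open>w\<close>; \<open>R\<close> is this inverse in the coordinates of
    \<open>real^2\<close>.\<close>
  define R where "R = (\<lambda>x. vec_of_complex (cnj w * complex_of_vec x))"
  have ww: "cnj w * w = 1"
    using complex_norm_square[of w] w by (simp add: mult.commute)
  have linR: "linear R"
    unfolding R_def
    by (intro linear_compose[OF linear_complex_of_vec, unfolded o_def]
          linear_compose[OF _ linear_vec_of_complex, unfolded o_def])
       (rule linearI, auto simp: algebra_simps)
  have orth: "orthogonal_transformation R"
    unfolding orthogonal_transformation using linR w
    by (auto simp: R_def norm_vec_of_complex norm_complex_of_vec norm_mult)
  define A where "A = complex_of_vec -` box l u"
  have A: "A = box (vec_of_complex l) (vec_of_complex u)"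
    by (auto simp: A_def complex_of_vec_def vec_of_complex_def mem_box_cart forall_2 in_box_complex_iff)
  have img: "complex_of_vec -` ((*) w -` box l u) = R ` A"
  proof (intro equalityI subsetI)
    fix x assume "x \<in> complex_of_vec -` ((*) w -` box l u)"
    then have x: "w * complex_of_vec x \<in> box l u" by simp
    have "x = R (vec_of_complex (w * complex_of_vec x))"
      using ww by (simp add: R_def mult.assoc[symmetric])
    moreover have "vec_of_complex (w * complex_of_vec x) \<in> A"
      using x by (simp add: A_def)
    ultimately show "x \<in> R ` A" by blast
  next
    fix y assume "y \<in> R ` A"
    then obtain x where "x \<in> A" "y = R x" by blast
    then show "y \<in> complex_of_vec -` ((*) w -` box l u)"
      using ww by (simp add: A_def R_def mult.assoc[symmetric] mult.commute[of w])
  qed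
  have Alm: "A \<in> lmeasurable"
    by (simp add: A)
  have [measurable]: "(*) w \<in> borel_measurable borel"
    by simp
  have vB: "(*) w -` box l u \<in> sets borel"
    using measurable_sets[of "(*) w" borel borel "box l u"] by simp
  have RB: "R ` A \<in> sets borel"
    unfolding img[symmetric]
    using measurable_sets[OF measurable_complex_of_vec vB] by simp
  have Rlm: "R ` A \<in> lmeasurable"
    using measurable_orthogonal_image[OF orth Alm] .
  have "emeasure (distr lborel borel ((*) w)) (box l u)
      = emeasure lborel ((*) w -` box l u)"
    by (subst emeasure_distr) simp_all
  also have "\<dots> = emeasure (distr lborel borel complex_of_vec) ((*) w -` box l u)"
    by (simp add: lborel_complex_of_vec)
  also have "\<dots> = emeasure lborel (R ` A)"
    using vB by (subst emeasure_distr) (simp_all add: img)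
  \<comment> \<open>The orthogonal image theorem concerns the completed measure. The two measures
    agree here because the rotated box is Borel.\<close>
  also have "\<dots> = emeasure lebesgue (R ` A)"
    using RB by simp
  also have "\<dots> = emeasure lebesgue A"
    using measure_orthogonal_image[OF orth Alm] Rlm Alm
    by (metis emeasure_eq_measure2)
  also have "\<dots> = emeasure (distr lborel borel complex_of_vec) (box l u)"
    by (subst emeasure_distr) (simp_all add: A_def[symmetric], simp add: A)
  also have "\<dots> = emeasure lborel (box l u)"
    by (simp add: lborel_complex_of_vec)
  also have "\<dots> = (\<Prod>b\<in>Basis. (u - l) \<bullet> b)"
    using le by (rule emeasure_lborel_box)
  finally show "emeasure (distr lborel borel ((*) w)) (box l u) = (\<Prod>b\<in>Basis. (u - l) \<bullet> b)" .
qed simp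

subsection \<open>Area integrals over the disc\<close>

lemma nn_integral_disc_area:
  assumes "f \<in> borel_measurable (restrict_space borel (ball 0 1))"
  shows "(\<integral>\<^sup>+z. f z \<partial>disc_area)
    = (\<integral>\<^sup>+z. ennreal (1 / pi) * f z * indicator (ball 0 1) z \<partial>lborel)"
proof -
  have [measurable]: "f \<in> borel_measurable (restrict_space lborel (ball 0 1))"
    using assms by (simp cong: measurable_cong_sets add: sets_restrict_space)
  have "(\<integral>\<^sup>+z. f z \<partial>disc_area) = ennreal (1 / pi) * (\<integral>\<^sup>+z. f z \<partial>restrict_space lborel (ball 0 1))"
    unfolding disc_area_def by (rule nn_integral_scale_measure) measurable
  also have "\<dots> = (\<integral>\<^sup>+z. ennreal (1 / pi) * f z \<partial>restrict_space lborel (ball 0 1))"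
    by (rule nn_integral_cmult[symmetric]) measurable
  also have "\<dots> = (\<integral>\<^sup>+z. ennreal (1 / pi) * f z * indicator (ball 0 1) z \<partial>lborel)"
    by (rule nn_integral_restrict_space) simp
  finally show ?thesis .
qed

section \<open>Distribution and moments of |z|^2 under normalized area\<close>

lemma emeasure_disc_area_ball:
  assumes "0 \<le> r" "r \<le> 1"
  shows "emeasure disc_area (ball 0 r) = ennreal (r\<^sup>2)"
proof -
  have "emeasure disc_area (ball 0 r) = ennreal (1 / pi) * emeasure lborel (ball (0::complex) r)"
    using assms by (simp add: disc_area_def emeasure_restrict_space subset_ball)
  also have "\<dots> = ennreal (1 / pi) * ennreal (pi * r\<^sup>2)"
    using assms by (simp add: emeasure_ball unit_ball_vol_2)
  also have "\<dots> = ennreal (r\<^sup>2)"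
    by (simp flip: ennreal_mult)
  finally show ?thesis .
qed

lemma emeasure_disc_area_cball:
  assumes "0 \<le> r" "r < 1"
  shows "emeasure disc_area (cball 0 r) = ennreal (r\<^sup>2)"
proof -
  have "emeasure disc_area (cball 0 r) = ennreal (1 / pi) * emeasure lborel (cball (0::complex) r)"
    using assms by (simp add: disc_area_def emeasure_restrict_space subset_iff)
  also have "\<dots> = ennreal (1 / pi) * ennreal (pi * r\<^sup>2)"
    using assms by (simp add: emeasure_cball unit_ball_vol_2)
  also have "\<dots> = ennreal (r\<^sup>2)"
    by (simp flip: ennreal_mult)
  finally show ?thesis .
qed

lemma space_disc_area [simp]: "space disc_area = ball 0 1"
  by (simp add: disc_area_def space_scale_measure space_restrict_space)

lemma sets_disc_area: "sets disc_area = sets (restrict_space borel (ball 0 1))"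
  by (simp add: disc_area_def sets_restrict_space)

lemma prob_space_disc_area: "prob_space disc_area"
  using emeasure_disc_area_ball[of 1] by (intro prob_spaceI) simp

lemma measurable_disc_areaI:
  "f \<in> borel_measurable borel \<Longrightarrow> f \<in> borel_measurable disc_area"
  by (simp add: measurable_cong_sets[OF sets_disc_area refl] measurable_restrict_space1)

text \<open>The disc of radius sqrt x has normalized area x, so the distribution function of |z|^2
  is that of the uniform law. This takes the place of polar coordinates for radial
  integrals.\<close>

lemma distr_disc_area_cmod_sq:
  "distr disc_area borel (\<lambda>z. (cmod z)\<^sup>2) = uniform_measure lborel {0..1::real}"
proof (rule cdf_unique)
  have m: "(\<lambda>z. (cmod z)\<^sup>2) \<in> borel_measurable disc_area"
    by (rule measurable_disc_areaI) measurable
  interpret D: prob_space disc_area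
    by (rule prob_space_disc_area)
  show "real_distribution (distr disc_area borel (\<lambda>z. (cmod z)\<^sup>2))"
    using D.prob_space_distr[OF m] by (simp add: real_distribution_def real_distribution_axioms_def)
  show "real_distribution (uniform_measure lborel {0..1::real})"
    using prob_space_uniform_measure[of lborel "{0..1::real}"]
    by (simp add: real_distribution_def real_distribution_axioms_def)
  show "cdf (distr disc_area borel (\<lambda>z. (cmod z)\<^sup>2)) = cdf (uniform_measure lborel {0..1::real})"
  proof
    fix x :: real
    have "cdf (distr disc_area borel (\<lambda>z. (cmod z)\<^sup>2)) x
        = measure disc_area {z\<in>ball 0 1. (cmod z)\<^sup>2 \<le> x}"
      unfolding cdf_def by (subst measure_distr[OF m]) (auto intro!: arg_cong[where f="measure disc_area"])
    also have "\<dots> = (if x < 0 then 0 else if x < 1 then x else 1)"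
    proof -
      consider "x < 0" | "0 \<le> x" "x < 1" | "1 \<le> x" by linarith
      then show ?thesis
      proof cases
        case 1
        then have "{z\<in>ball 0 1. (cmod z)\<^sup>2 \<le> x} = {}"
          by (auto simp: not_le intro: less_le_trans)
        then show ?thesis using 1 by (simp only: measure_empty if_True)
      next
        case 2
        have "{z\<in>ball 0 1. (cmod z)\<^sup>2 \<le> x} = cball 0 (sqrt x)"
        proof -
          have "cmod z < 1" if "cmod z \<le> sqrt x" for z
            using that 2 real_sqrt_lt_1_iff[of x] by linarith
          then show ?thesis
            using 2 by (auto simp: real_le_rsqrt sqrt_ge_absD)
        qed
        then show ?thesis
          using 2 emeasure_disc_area_cball[of "sqrt x"] by (simp add: measure_def)
      next
        case 3
        have "(cmod z)\<^sup>2 \<le> x" if "cmod z < 1" for z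
        proof -
          have "(cmod z)\<^sup>2 \<le> 1" using that by (intro power_le_one) auto
          then show ?thesis using 3 by linarith
        qed
        then have "{z\<in>ball 0 1. (cmod z)\<^sup>2 \<le> x} = ball 0 1"
          by auto
        then show ?thesis using 3 emeasure_disc_area_ball[of 1] by (simp add: measure_def)
      qed
    qed
    also have "\<dots> = cdf (uniform_measure lborel {0..1::real}) x"
    proof -
      have "{0..1} \<inter> {..x} = {0..min 1 x}" by auto
      then show ?thesis
        unfolding cdf_def by (subst measure_uniform_measure) (auto simp: min_def)
    qed
    finally show "cdf (distr disc_area borel (\<lambda>z. (cmod z)\<^sup>2)) x
      = cdf (uniform_measure lborel {0..1::real}) x" .
  qed
qed

text \<open>With t = |z|^2 uniform on [0,1], the integral becomes that of t^k (1 - t), which is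
  1/(k+1) - 1/(k+2).\<close>

lemma disc_area_moment:
  "(\<integral>\<^sup>+z. ennreal ((cmod z) ^ (2 * k) * (1 - (cmod z)\<^sup>2)) \<partial>disc_area)
    = ennreal (1 / (real (k + 1) * real (k + 2)))"
proof -
  have m: "(\<lambda>z. (cmod z)\<^sup>2) \<in> measurable disc_area borel"
    by (rule measurable_disc_areaI) measurable
  let ?g = "\<lambda>t::real. t ^ k * (1 - t)"
  let ?F = "\<lambda>t::real. t ^ (k + 1) / real (k + 1) - t ^ (k + 2) / real (k + 2)"
  have "(\<integral>\<^sup>+z. ennreal ((cmod z) ^ (2 * k) * (1 - (cmod z)\<^sup>2)) \<partial>disc_area)
    = (\<integral>\<^sup>+z. ennreal (?g ((cmod z)\<^sup>2)) \<partial>disc_area)"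
    by (simp add: power_mult)
  also have "\<dots> = (\<integral>\<^sup>+t. ennreal (?g t) \<partial>distr disc_area borel (\<lambda>z. (cmod z)\<^sup>2))"
    by (rule nn_integral_distr[OF m, symmetric]) measurable
  also have "\<dots> = (\<integral>\<^sup>+t. ennreal (?g t) * indicator {0..1} t \<partial>lborel)"
    unfolding distr_disc_area_cmod_sq
    by (subst nn_integral_uniform_measure) (simp_all add: divide_ennreal_def)
  also have "\<dots> = ennreal (?F 1 - ?F 0)"
  proof (rule nn_integral_FTC_Icc)
    fix t :: real assume t: "t \<in> {0..1}"
    show "(?F has_real_derivative ?g t) (at t)"
      by (rule derivative_eq_intros refl | simp)+ (simp add: algebra_simps)
    show "0 \<le> ?g t" using t by simp
  qed auto
  also have "?F 1 - ?F 0 = 1 / (real (k + 1) * real (k + 2))"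
    by (simp add: field_simps)
  finally show ?thesis .
qed

section \<open>Parseval's identity for the weight 1 - |z|^2\<close>

lemma power_mult_cnj_power: "z ^ k * cnj z ^ k = complex_of_real ((cmod z) ^ (2 * k))"
proof -
  have "complex_of_real ((cmod z) ^ (2 * k)) = complex_of_real ((cmod z)\<^sup>2) ^ k"
    by (simp add: power_mult)
  then show ?thesis
    by (simp only: complex_norm_square power_mult_distrib)
qed

text \<open>A rotation by the angle \<open>t\<close> preserves the measure and the radial factor but
  multiplies the integrand by \<open>cis ((k - m) * t)\<close>. For a suitable angle this factor is
  -1, so the integral equals its own negative. A non-integrable integrand fits in, its Bochner
  integral being 0 by convention.\<close>

lemma radial_monomial_orthogonal:
  fixes g :: "real \<Rightarrow> real"
  assumes [measurable]: "g \<in> borel_measurable borel" and km: "k \<noteq> m"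
  shows "(\<integral>z. z ^ k * cnj z ^ m * of_real (g (cmod z)) \<partial>lborel) = 0" (is "?I = 0")
proof -
  let ?f = "\<lambda>z. z ^ k * cnj z ^ m * complex_of_real (g (cmod z))"
  \<comment> \<open>The angle for which (k - m) t = pi.\<close>
  define t where "t = pi / (real k - real m)"
  have t: "real k * t - real m * t = pi"
  proof -
    have "(real k - real m) * t = pi" using km by (simp add: t_def)
    then show ?thesis by (simp add: left_diff_distrib)
  qed
  have cnj_meas [measurable]: "cnj \<in> borel_measurable borel"
    by (intro borel_measurable_continuous_onI continuous_intros)
  have "?I = (\<integral>z. ?f z \<partial>distr lborel borel ((*) (cis t)))"
    by (simp add: lborel_distr_complex_rotation)
  also have "\<dots> = (\<integral>z. ?f (cis t * z) \<partial>lborel)"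
    by (rule integral_distr) measurable
  also have "\<dots> = (\<integral>z. - ?f z \<partial>lborel)"
  proof (rule Bochner_Integration.integral_cong[OF refl])
    fix z
    have "cis t ^ k * cnj (cis t) ^ m = cis (real k * t - real m * t)"
      by (simp add: cis_cnj Complex.DeMoivre cis_mult del: cis_inverse)
    then have "cis t ^ k * cnj (cis t) ^ m = -1"
      by (simp add: t)
    moreover have "?f (cis t * z) = (cis t ^ k * cnj (cis t) ^ m) * ?f z"
      by (simp add: power_mult_distrib norm_mult mult_ac)
    ultimately show "?f (cis t * z) = - ?f z" by simp
  qed
  also have "\<dots> = - ?I"
    by simp
  finally show ?thesis by simp
qed

text \<open>Monotone convergence along concentric balls of radius 1 - 1/(n+2). On each of them a
  power series convergent in the disc has uniformly bounded partial sums; the shift by 2 makes every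
  radius positive.\<close>

lemma nn_integral_disc_area_SUP:
  assumes "f \<in> borel_measurable (restrict_space borel (ball 0 1))"
  shows "(\<integral>\<^sup>+z. f z \<partial>disc_area)
    = (SUP n. \<integral>\<^sup>+z. ennreal (1 / pi) * f z * indicator (ball 0 (1 - 1 / real (n + 2))) z \<partial>lborel)"
proof -
  define \<rho> where "\<rho> = (\<lambda>n. 1 - 1 / real (n + 2))"
  define h where "h = (\<lambda>n z. ennreal (1 / pi) * f z * indicator (ball 0 (\<rho> n)) z)"
  have \<rho>_mono: "\<rho> m \<le> \<rho> n" if "m \<le> n" for m n
    using that by (simp add: \<rho>_def frac_le)
  have meas: "h n \<in> borel_measurable lborel" for n
  proof -
    \<comment> \<open>Measurability of \<open>f\<close> is known on the disc only. It restricts to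
      the smaller ball, and the indicator then extends the integrand by 0 to the plane.\<close>
    have [measurable]: "f \<in> borel_measurable (restrict_space borel (ball 0 (\<rho> n)))"
      by (rule measurable_restrict_mono[OF assms]) (simp add: \<rho>_def subset_ball)
    have "(\<lambda>z. ennreal (1 / pi) * f z) \<in> borel_measurable (restrict_space borel (ball 0 (\<rho> n)))"
      by measurable
    then show ?thesis
      unfolding h_def by (subst (asm) borel_measurable_restrict_space_iff_ennreal) auto
  qed
  have inc: "incseq h"
    using \<rho>_mono unfolding incseq_def le_fun_def h_def
    by (intro allI impI mult_left_mono) (force simp: indicator_def)+
  have pt: "(SUP n. h n z) = ennreal (1 / pi) * f z * indicator (ball 0 1) z" for z
  proof (cases "z \<in> ball 0 1")
    case True
    then obtain n where "1 / real (n + 1) < 1 - cmod z"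
      using nat_approx_posE[of "1 - cmod z"] by (auto simp: add.commute)
    moreover have "1 / real (n + 2) \<le> 1 / real (n + 1)"
      by (simp add: field_simps)
    ultimately have "z \<in> ball 0 (\<rho> n)" by (simp add: \<rho>_def)
    then have hn: "h n z = ennreal (1 / pi) * f z" by (simp add: h_def)
    have "h m z \<le> ennreal (1 / pi) * f z" for m
      by (simp add: h_def indicator_def)
    then have "(SUP n. h n z) = ennreal (1 / pi) * f z"
      using hn by (intro antisym SUP_least) (metis SUP_upper UNIV_I)+
    then show ?thesis using True by simp
  next
    case False
    have "\<rho> n \<le> 1" for n by (simp add: \<rho>_def)
    then have "z \<notin> ball 0 (\<rho> n)" for n
      using False by (metis subset_ball subsetD)
    then show ?thesis using False by (simp add: h_def)
  qed
  have "(\<integral>\<^sup>+z. f z \<partial>disc_area) = (\<integral>\<^sup>+z. (SUP n. h n z) \<partial>lborel)"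
    unfolding pt by (rule nn_integral_disc_area[OF assms])
  also have "\<dots> = (SUP n. \<integral>\<^sup>+z. h n z \<partial>lborel)"
    by (rule nn_integral_monotone_convergence_SUP[OF inc meas])
  finally show ?thesis by (simp add: h_def \<rho>_def)
qed

text \<open>Orthogonality of monomials gives the identity for Taylor polynomials. On a ball of
  radius \<rho> < 1 these are uniformly bounded, so dominated convergence passes to
  \<open>F\<close>. The weight \<phi> carries the factor 1/pi of normalized area.\<close>

lemma parseval_truncated_disc:
  fixes F :: "complex \<Rightarrow> complex" and \<rho> :: real
  defines "\<phi> \<equiv> \<lambda>z. indicator (ball 0 \<rho>) z * ((1 - (cmod z)\<^sup>2) / pi)"
  assumes F: "F holomorphic_on ball 0 1" and \<rho>: "0 < \<rho>" "\<rho> < 1"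
  shows "(\<lambda>k. (cmod (fps_nth (fps_expansion F 0) k))\<^sup>2 * (\<integral>z. (cmod z) ^ (2 * k) * \<phi> z \<partial>lborel))
      sums (\<integral>z. (cmod (F z))\<^sup>2 * \<phi> z \<partial>lborel)"
    and "integrable lborel (\<lambda>z. (cmod (F z))\<^sup>2 * \<phi> z)"
    and "integrable lborel (\<lambda>z. (cmod z) ^ (2 * k) * \<phi> z)"
proof -
  define c where "c = (\<lambda>k. fps_nth (fps_expansion F 0) k)"
  \<comment> \<open>The profile of the radial weight \<phi>, in the form that
    \<open>radial_monomial_orthogonal\<close> expects.\<close>
  define g where "g = (\<lambda>r::real. (if r < \<rho> then 1 else 0) * ((1 - r\<^sup>2) / pi))"
  have \<phi>g: "\<phi> z = g (cmod z)" for z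
    by (simp add: \<phi>_def g_def indicator_def)
  have [measurable]: "g \<in> borel_measurable borel"
    unfolding g_def by measurable
  have [measurable]: "\<phi> \<in> borel_measurable borel"
    unfolding \<phi>g by measurable
  have cnj_meas [measurable]: "cnj \<in> borel_measurable borel"
    by (intro borel_measurable_continuous_onI continuous_intros)
  have \<phi>0: "0 \<le> \<phi> z" for z
    using \<rho> power_le_one[of "cmod z" 2] by (auto simp: \<phi>_def indicator_def)
  have \<phi>1: "\<phi> z \<le> indicator (ball 0 \<rho>) z" for z
  proof -
    have "1 - (cmod z)\<^sup>2 \<le> pi"
      using pi_gt3 by (smt (verit) zero_le_power2)
    then show ?thesis by (auto simp: \<phi>_def indicator_def)
  qed
  have int_ind: "integrable lborel (\<lambda>z::complex. C * indicator (ball 0 \<rho>) z)" for C :: real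
    using emeasure_lborel_ball_finite[of "0::complex" \<rho>] by (intro integrable_mult_right) simp
  have bound: "norm (q z * \<phi> z) \<le> norm (C * indicator (ball 0 \<rho>) z)"
    if "z \<in> ball 0 \<rho> \<Longrightarrow> \<bar>q z\<bar> \<le> C" for q :: "complex \<Rightarrow> real" and C z
  proof (cases "z \<in> ball 0 \<rho>")
    case True
    then have "\<bar>q z\<bar> * \<phi> z \<le> C * 1"
      using that \<phi>0[of z] \<phi>1[of z] by (intro mult_mono) auto
    then show ?thesis using True \<phi>0[of z] by (simp add: abs_mult)
  qed (simp add: \<phi>_def)
  have ser: "(\<lambda>k. c k * z ^ k) sums F z" if "cmod z < 1" for z
    using holomorphic_power_series[OF F, of z] that by (simp add: c_def fps_expansion_def)
  \<comment> \<open>Convergence at some \<open>r\<close> strictly between \<rho> and 1 forces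
    absolute convergence at \<rho>; the sum \<open>B\<close> of the resulting series dominates all
    partial sums on the ball.\<close>
  have summ: "summable (\<lambda>k. cmod (c k) * \<rho> ^ k)"
  proof -
    obtain r where r: "\<rho> < r" "r < 1" using \<rho> dense by blast
    then have "summable (\<lambda>k. c k * of_real r ^ k)"
      using ser[of "of_real r"] \<rho> by (simp add: sums_iff)
    from powser_insidea[OF this, of "of_real \<rho>"] show ?thesis
      using \<rho> r by (simp add: norm_mult norm_power)
  qed
  define B where "B = (\<Sum>k. cmod (c k) * \<rho> ^ k)"
  define P where "P = (\<lambda>N z. \<Sum>k<N. c k * z ^ k)"
  have [measurable]: "P N \<in> borel_measurable borel" for N
    unfolding P_def by measurable
  have PB: "cmod (P N z) \<le> B" if "z \<in> ball 0 \<rho>" for N z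
  proof -
    have "cmod (P N z) \<le> (\<Sum>k<N. cmod (c k) * \<rho> ^ k)"
      unfolding P_def using that
      by (intro order_trans[OF norm_sum] sum_mono)
         (auto simp: norm_mult norm_power intro!: mult_left_mono power_mono)
    also have "\<dots> \<le> B"
      unfolding B_def using \<rho> by (intro sum_le_suminf summ) auto
    finally show ?thesis .
  qed
  have PB2: "norm ((cmod (P N z))\<^sup>2 * \<phi> z) \<le> B\<^sup>2 * indicator (ball 0 \<rho>) z" for N z
  proof -
    have "(cmod (P N z))\<^sup>2 \<le> B\<^sup>2" if "z \<in> ball 0 \<rho>"
      using PB[OF that, of N] by (intro power_mono) auto
    then show ?thesis
      using bound[of z "\<lambda>z. (cmod (P N z))\<^sup>2" "B\<^sup>2"] by simp
  qed
  have lim: "(\<lambda>N. (cmod (P N z))\<^sup>2 * \<phi> z) \<longlonglongrightarrow> (cmod (F z))\<^sup>2 * \<phi> z" for z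
  proof (cases "z \<in> ball 0 \<rho>")
    case True
    then have "(\<lambda>N. P N z) \<longlonglongrightarrow> F z"
      using ser[of z] \<rho> by (simp add: P_def sums_def)
    then show ?thesis by (intro tendsto_intros)
  qed (simp add: \<phi>_def)
  have Fmeas: "(\<lambda>z. (cmod (F z))\<^sup>2 * \<phi> z) \<in> borel_measurable lborel"
    by (rule borel_measurable_LIMSEQ_real[OF lim]) measurable
  have Pmeas: "(\<lambda>z. (cmod (P N z))\<^sup>2 * \<phi> z) \<in> borel_measurable lborel" for N
    by measurable
  have dom: "integrable lborel (\<lambda>z. (cmod (F z))\<^sup>2 * \<phi> z)"
    by (rule integrable_dominated_convergence[OF Fmeas Pmeas int_ind AE_I2[OF lim] AE_I2[OF PB2]])
  have dom_lim: "(\<lambda>N. \<integral>z. (cmod (P N z))\<^sup>2 * \<phi> z \<partial>lborel) \<longlonglongrightarrow> (\<integral>z. (cmod (F z))\<^sup>2 * \<phi> z \<partial>lborel)"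
    by (rule integral_dominated_convergence[OF Fmeas Pmeas int_ind AE_I2[OF lim] AE_I2[OF PB2]])
  show "integrable lborel (\<lambda>z. (cmod (F z))\<^sup>2 * \<phi> z)" by (rule dom)
  have int_mono: "integrable lborel (\<lambda>z. z ^ k * cnj z ^ m * of_real (\<phi> z))" for k m
  proof (rule Bochner_Integration.integrable_bound[OF int_ind[of 1]])
    show "AE z in lborel. norm (z ^ k * cnj z ^ m * complex_of_real (\<phi> z)) \<le> norm (1 * indicator (ball 0 \<rho>) z :: real)"
    proof (intro AE_I2)
      fix z :: complex
      have "cmod z ^ k * cmod z ^ m \<le> 1" if "z \<in> ball 0 \<rho>"
        using that \<rho> by (intro mult_le_one power_le_one) auto
      then show "norm (z ^ k * cnj z ^ m * complex_of_real (\<phi> z)) \<le> norm (1 * indicator (ball 0 \<rho>) z :: real)"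
        using bound[of z "\<lambda>z. cmod z ^ k * cmod z ^ m" 1]
        by (simp add: norm_mult norm_power abs_mult)
    qed
  qed measurable
  show "integrable lborel (\<lambda>z. (cmod z) ^ (2 * k) * \<phi> z)" for k
  proof -
    have "z ^ k * cnj z ^ k * of_real (\<phi> z) = complex_of_real ((cmod z) ^ (2 * k) * \<phi> z)" for z
      by (simp only: power_mult_cnj_power of_real_mult)
    then show ?thesis
      using int_mono[of k k] by (simp only: complex_of_real_integrable_eq)
  qed
  \<comment> \<open>The square of a polynomial's modulus is a finite double sum; after integration
    only its diagonal survives.\<close>
  have "(\<integral>z. (cmod (P N z))\<^sup>2 * \<phi> z \<partial>lborel)
      = (\<Sum>k<N. (cmod (c k))\<^sup>2 * (\<integral>z. (cmod z) ^ (2 * k) * \<phi> z \<partial>lborel))" for N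
  proof -
    have expand: "complex_of_real ((cmod (P N z))\<^sup>2 * \<phi> z)
        = (\<Sum>k<N. \<Sum>m<N. c k * cnj (c m) * (z ^ k * cnj z ^ m * of_real (\<phi> z)))" for z
    proof -
      have "complex_of_real ((cmod (P N z))\<^sup>2 * \<phi> z) = P N z * cnj (P N z) * of_real (\<phi> z)"
        by (simp only: of_real_mult complex_norm_square)
      also have "\<dots> = (\<Sum>k<N. \<Sum>m<N. (c k * z ^ k) * cnj (c m * z ^ m)) * of_real (\<phi> z)"
        by (simp only: P_def cnj_sum sum_product)
      also have "\<dots> = (\<Sum>k<N. \<Sum>m<N. c k * cnj (c m) * (z ^ k * cnj z ^ m * of_real (\<phi> z)))"
        unfolding sum_distrib_right by (intro sum.cong refl) (simp add: mult_ac)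
      finally show ?thesis .
    qed
    have diag: "(\<integral>z. z ^ k * cnj z ^ m * of_real (\<phi> z) \<partial>lborel)
        = (if k = m then complex_of_real (\<integral>z. (cmod z) ^ (2 * k) * \<phi> z \<partial>lborel) else 0)" for k m
    proof (cases "k = m")
      case True
      have "z ^ k * cnj z ^ k * of_real (\<phi> z) = complex_of_real ((cmod z) ^ (2 * k) * \<phi> z)" for z
        by (simp only: power_mult_cnj_power of_real_mult)
      then have "(\<integral>z. z ^ k * cnj z ^ k * of_real (\<phi> z) \<partial>lborel)
          = complex_of_real (\<integral>z. (cmod z) ^ (2 * k) * \<phi> z \<partial>lborel)"
        by (simp only: integral_complex_of_real)
      then show ?thesis using True by simp
    next
      case False
      then show ?thesis
        using radial_monomial_orthogonal[of g k m] by (simp add: \<phi>g)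
    qed
    have "complex_of_real (\<integral>z. (cmod (P N z))\<^sup>2 * \<phi> z \<partial>lborel)
      = (\<integral>z. complex_of_real ((cmod (P N z))\<^sup>2 * \<phi> z) \<partial>lborel)"
      by (rule integral_complex_of_real[symmetric])
    also have "\<dots> = (\<Sum>k<N. \<Sum>m<N. c k * cnj (c m) * (\<integral>z. z ^ k * cnj z ^ m * of_real (\<phi> z) \<partial>lborel))"
      unfolding expand using int_mono
      by (subst Bochner_Integration.integral_sum; (intro Bochner_Integration.integrable_sum integrable_mult_right int_mono)?)
         (subst Bochner_Integration.integral_sum; simp)
    also have "\<dots> = (\<Sum>k<N. \<Sum>m<N. if k = m then c k * cnj (c m) * complex_of_real (\<integral>z. (cmod z) ^ (2 * k) * \<phi> z \<partial>lborel) else 0)"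
      unfolding diag by (intro sum.cong) auto
    also have "\<dots> = (\<Sum>k<N. c k * cnj (c k) * complex_of_real (\<integral>z. (cmod z) ^ (2 * k) * \<phi> z \<partial>lborel))"
      by (intro sum.cong) auto
    also have "\<dots> = complex_of_real (\<Sum>k<N. (cmod (c k))\<^sup>2 * (\<integral>z. (cmod z) ^ (2 * k) * \<phi> z \<partial>lborel))"
      by (simp only: of_real_sum of_real_mult complex_norm_square)
    finally show ?thesis
      by (simp only: of_real_eq_iff)
  qed
  then show "(\<lambda>k. (cmod (fps_nth (fps_expansion F 0) k))\<^sup>2 * (\<integral>z. (cmod z) ^ (2 * k) * \<phi> z \<partial>lborel))
      sums (\<integral>z. (cmod (F z))\<^sup>2 * \<phi> z \<partial>lborel)"
    using dom_lim by (simp add: sums_def c_def)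
qed

text \<open>Let the truncation radius tend to 1 in \<open>parseval_truncated_disc\<close>. Both
  sides increase with the radius, and the truncated moments \<open>m n k\<close> increase to
  1/((k+1)(k+2)).\<close>

lemma nn_integral_weighted_disc_area:
  fixes F :: "complex \<Rightarrow> complex"
  assumes F: "F holomorphic_on ball 0 1"
  shows "(\<integral>\<^sup>+z. ennreal ((cmod (F z))\<^sup>2 * (1 - (cmod z)\<^sup>2)) \<partial>disc_area)
    = (\<Sum>k. ennreal ((cmod (fps_nth (fps_expansion F 0) k))\<^sup>2 / (real (k + 1) * real (k + 2))))"
proof -
  define c where "c = (\<lambda>k. fps_nth (fps_expansion F 0) k)"
  define \<rho> where "\<rho> = (\<lambda>n. 1 - 1 / real (n + 2))"
  define \<phi> where "\<phi> = (\<lambda>n z. indicator (ball 0 (\<rho> n)) z * ((1 - (cmod z)\<^sup>2) / pi))"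
  have \<rho>: "0 < \<rho> n" "\<rho> n < 1" for n
    by (simp_all add: \<rho>_def)
  have \<rho>_mono: "\<rho> m \<le> \<rho> n" if "m \<le> n" for m n
    using that by (simp add: \<rho>_def frac_le)
  have \<phi>0: "0 \<le> \<phi> n z" for n z
    using \<rho>[of n] power_le_one[of "cmod z" 2] by (auto simp: \<phi>_def indicator_def)
  have \<phi>_mono: "\<phi> m z \<le> \<phi> n z" if "m \<le> n" for m n z
    using \<phi>0[of n z] \<rho>_mono[OF that] by (auto simp: \<phi>_def indicator_def)
  have trunc: "(\<integral>\<^sup>+z. ennreal (1 / pi) * ennreal (q z * (1 - (cmod z)\<^sup>2)) * indicator (ball 0 (\<rho> n)) z \<partial>lborel)
      = ennreal (\<integral>z. q z * \<phi> n z \<partial>lborel)"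
    if "\<And>z. 0 \<le> q z" "integrable lborel (\<lambda>z. q z * \<phi> n z)" for q :: "complex \<Rightarrow> real" and n
  proof -
    have "ennreal (1 / pi) * ennreal (q z * (1 - (cmod z)\<^sup>2)) * indicator (ball 0 (\<rho> n)) z
        = ennreal (q z * \<phi> n z)" for z
      by (auto simp: \<phi>_def indicator_def simp flip: ennreal_mult')
    then show ?thesis
      using that \<phi>0 by (simp add: nn_integral_eq_integral)
  qed
  have P: "(\<lambda>k. (cmod (c k))\<^sup>2 * (\<integral>z. (cmod z) ^ (2 * k) * \<phi> n z \<partial>lborel))
      sums (\<integral>z. (cmod (F z))\<^sup>2 * \<phi> n z \<partial>lborel)"
    "integrable lborel (\<lambda>z. (cmod (F z))\<^sup>2 * \<phi> n z)"
    "integrable lborel (\<lambda>z. (cmod z) ^ (2 * k) * \<phi> n z)" for n k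
    unfolding \<phi>_def c_def by (rule parseval_truncated_disc[OF F \<rho>])+
  define m where "m n k = (\<integral>z. (cmod z) ^ (2 * k) * \<phi> n z \<partial>lborel)" for n k
  have m0: "0 \<le> m n k" for n k
    unfolding m_def using \<phi>0 by (intro integral_nonneg_AE) auto
  have m_mono: "m n k \<le> m n' k" if "n \<le> n'" for n n' k
    unfolding m_def using \<phi>_mono[OF that] by (intro integral_mono P mult_left_mono) auto
  have meas: "(\<lambda>z. ennreal ((cmod (G z))\<^sup>2 * (1 - (cmod z)\<^sup>2))) \<in> borel_measurable (restrict_space borel (ball 0 1))"
    if "G holomorphic_on ball 0 1" for G
    using holomorphic_on_imp_continuous_on[OF that]
    by (intro measurable_compose[OF _ measurable_ennreal] borel_measurable_continuous_on_restrict continuous_intros)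
  have sup: "(\<integral>\<^sup>+z. f z \<partial>disc_area)
      = (SUP n. \<integral>\<^sup>+z. ennreal (1 / pi) * f z * indicator (ball 0 (\<rho> n)) z \<partial>lborel)"
    if "f \<in> borel_measurable (restrict_space borel (ball 0 1))" for f
    unfolding \<rho>_def by (rule nn_integral_disc_area_SUP[OF that])
  \<comment> \<open>The same exhaustion applied to the monomial z^k identifies the limit with the
    full moment.\<close>
  have msup: "(SUP n. ennreal (m n k)) = ennreal (1 / (real (k + 1) * real (k + 2)))" for k
  proof -
    have "(\<integral>\<^sup>+z. ennreal ((cmod z) ^ (2 * k) * (1 - (cmod z)\<^sup>2)) \<partial>disc_area) = (SUP n. ennreal (m n k))"
    proof (subst sup)
      show "(\<lambda>z. ennreal ((cmod z) ^ (2 * k) * (1 - (cmod z)\<^sup>2))) \<in> borel_measurable (restrict_space borel (ball 0 1))"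
        using meas[of "\<lambda>z. z ^ k"] by (simp add: norm_power power_even_eq holomorphic_intros)
    qed (simp add: trunc P(3) m_def)
    then show ?thesis
      by (simp only: disc_area_moment)
  qed
  have "(\<integral>\<^sup>+z. ennreal ((cmod (F z))\<^sup>2 * (1 - (cmod z)\<^sup>2)) \<partial>disc_area)
      = (SUP n. ennreal (\<integral>z. (cmod (F z))\<^sup>2 * \<phi> n z \<partial>lborel))"
    by (subst sup[OF meas[OF F]]) (simp add: trunc P(2))
  also have "\<dots> = (SUP n. \<Sum>k. ennreal ((cmod (c k))\<^sup>2) * ennreal (m n k))"
  proof (intro SUP_cong refl)
    fix n
    show "ennreal (\<integral>z. (cmod (F z))\<^sup>2 * \<phi> n z \<partial>lborel) = (\<Sum>k. ennreal ((cmod (c k))\<^sup>2) * ennreal (m n k))"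
      using suminf_ennreal_eq[OF _ P(1)[of n, folded m_def], symmetric] m0 by (simp add: ennreal_mult)
  qed
  \<comment> \<open>Supremum and series commute because each term is nonnegative and increasing in
    \<open>n\<close>.\<close>
  also have "\<dots> = (\<Sum>k. SUP n. ennreal ((cmod (c k))\<^sup>2) * ennreal (m n k))"
    using m_mono by (intro ennreal_suminf_SUP_eq[symmetric]) (auto simp: incseq_def intro!: mult_left_mono ennreal_leI)
  also have "\<dots> = (\<Sum>k. ennreal ((cmod (c k))\<^sup>2 / (real (k + 1) * real (k + 2))))"
  proof (intro suminf_cong)
    fix k
    have "(SUP n. ennreal ((cmod (c k))\<^sup>2) * ennreal (m n k)) = ennreal ((cmod (c k))\<^sup>2) * (SUP n. ennreal (m n k))"
      by (rule SUP_mult_left_ennreal[symmetric])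
    then show "(SUP n. ennreal ((cmod (c k))\<^sup>2) * ennreal (m n k)) = ennreal ((cmod (c k))\<^sup>2 / (real (k + 1) * real (k + 2)))"
      unfolding msup by (simp flip: ennreal_mult)
  qed
  finally show ?thesis by (simp add: c_def)
qed

subsection \<open>Cesaro means\<close>

text \<open>One step of the telescoping: \<open>s\<close> is meant as the sum of the first
  \<open>a\<close> terms and \<open>h\<close> as the next one. Multiplied by a(a+1), it is the
  expansion of the squares.\<close>

lemma cesaro_step_identity:
  fixes s h :: complex and a :: real
  assumes "a > 0"
  shows "(cmod (of_real a * h - s))\<^sup>2 / (a * (a + 1))
    = (cmod h)\<^sup>2 - (cmod (s + h))\<^sup>2 / (a + 1) + (cmod s)\<^sup>2 / a"
  using assms unfolding cmod_power2 by (simp add: divide_simps) (simp add: power2_eq_square algebra_simps)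

text \<open>The right side is the sum of squared deviations of H_0,...,H_K from their mean.
  Appending one more term raises it by exactly the corresponding summand on the left.\<close>

lemma sum_cesaro_differences:
  fixes H :: "nat \<Rightarrow> complex"
  shows "(\<Sum>k<K. (cmod (of_nat (k + 1) * H (k + 1) - (\<Sum>i\<le>k. H i)))\<^sup>2 / (real (k + 1) * real (k + 2)))
    = (\<Sum>k\<le>K. (cmod (H k))\<^sup>2) - (cmod (\<Sum>i\<le>K. H i))\<^sup>2 / real (K + 1)"
proof (induction K)
  case (Suc K)
  show ?case
    using cesaro_step_identity[of "real (K + 1)" "H (K + 1)" "\<Sum>i\<le>K. H i"] Suc.IH
    by (simp add: add.commute)
qed simp

lemma sum_inverse_consecutive:
  assumes "K \<le> M"
  shows "(\<Sum>k=K..<M. 1 / (real (k + 1) * real (k + 2))) = 1 / real (K + 1) - 1 / real (M + 1)"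
  using assms
proof (induction rule: dec_induct)
  case (step n)
  have "1 / (real (n + 1) * real (n + 2)) = 1 / real (n + 1) - 1 / real (Suc n + 1)"
    by (simp add: divide_simps)
  then show ?case
    using step by (simp del: of_nat_Suc of_nat_add)
qed simp

text \<open>The Cesaro means are Cauchy, with (K+1) |\<sigma>_M - \<sigma>_K|^2 bounded by the part
  of the series from K to M. Subtracting their limit \<tau> from H, the term missing in
  \<open>sum_cesaro_differences\<close> becomes (K+1) |\<tau> - \<sigma>_K|^2, and the tail of the
  series pays for it.\<close>

lemma square_summable_shift:
  fixes H :: "nat \<Rightarrow> complex" and D :: real
  assumes D: "\<And>K. (\<Sum>k<K. (cmod (of_nat (k + 1) * H (k + 1) - (\<Sum>i\<le>k. H i)))\<^sup>2
      / (real (k + 1) * real (k + 2))) \<le> D"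
  obtains \<tau> where "\<And>K. (\<Sum>k\<le>K. (cmod (H k - \<tau>))\<^sup>2) \<le> D"
proof -
  define S where "S = (\<lambda>k. \<Sum>i\<le>k. H i)"
  define \<sigma> where "\<sigma> = (\<lambda>k. S k / of_nat (k + 1))"
  define d where "d = (\<lambda>k. of_nat (k + 1) * H (k + 1) - S k)"
  define w where "w = (\<lambda>k. real (k + 1) * real (k + 2))"
  have w: "w k > 0" for k by (simp add: w_def)
  have D': "(\<Sum>k<K. (cmod (d k))\<^sup>2 / w k) \<le> D" for K
    using D[of K] by (simp add: d_def S_def w_def)
  have D0: "0 \<le> D"
    using D'[of 0] by simp
  have diff: "\<sigma> (Suc k) - \<sigma> k = d k / of_real (w k)" for k
  proof -
    have "of_nat (k + 1) \<noteq> (0::complex)" "of_nat (k + 2) \<noteq> (0::complex)"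
      unfolding of_nat_eq_0_iff by simp_all
    moreover have "S (Suc k) = S k + H (k + 1)" by (simp add: S_def)
    ultimately show ?thesis
      by (simp add: \<sigma>_def d_def w_def divide_simps del: of_nat_add of_nat_Suc)
         (simp add: algebra_simps)
  qed
  \<comment> \<open>The tail estimate is kept together with the initial sum over k < K, since the
    two pieces of the series jointly cost no more than \<open>D\<close>.\<close>
  have tail: "real (K + 1) * (cmod (\<sigma> M - \<sigma> K))\<^sup>2 + (\<Sum>k<K. (cmod (d k))\<^sup>2 / w k) \<le> D"
    if "K \<le> M" for K M
  proof -
    have "cmod (\<sigma> M - \<sigma> K) = cmod (\<Sum>k=K..<M. \<sigma> (Suc k) - \<sigma> k)"
      using that by (simp add: sum_Suc_diff')
    also have "\<dots> \<le> (\<Sum>k=K..<M. cmod (d k) / w k)"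
      unfolding diff using w by (intro order_trans[OF norm_sum] sum_mono) (simp add: norm_divide less_imp_le)
    \<comment> \<open>The weight is split evenly for Cauchy-Schwarz: one factor gives the given
      series, the other gives the sum of 1/((k+1)(k+2)), which telescopes to at most
      1/(K+1).\<close>
    also have "\<dots> = (\<Sum>k=K..<M. (cmod (d k) / sqrt (w k)) * (1 / sqrt (w k)))"
      using w by (intro sum.cong) (simp_all add: less_imp_le)
    finally have "(cmod (\<sigma> M - \<sigma> K))\<^sup>2
        \<le> (\<Sum>k=K..<M. (cmod (d k) / sqrt (w k)) * (1 / sqrt (w k)))\<^sup>2"
      by (intro power_mono) auto
    also have "\<dots> \<le> (\<Sum>k=K..<M. (cmod (d k) / sqrt (w k))\<^sup>2) * (\<Sum>k=K..<M. (1 / sqrt (w k))\<^sup>2)"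
      by (rule Cauchy_Schwarz_ineq_sum)
    also have "\<dots> = (\<Sum>k=K..<M. (cmod (d k))\<^sup>2 / w k) * (1 / real (K + 1) - 1 / real (M + 1))"
      unfolding sum_inverse_consecutive[OF that, symmetric]
      using w by (simp add: power_divide less_imp_le) (simp add: w_def)
    also have "\<dots> \<le> (\<Sum>k=K..<M. (cmod (d k))\<^sup>2 / w k) * (1 / real (K + 1))"
      by (intro mult_left_mono sum_nonneg divide_nonneg_pos w) auto
    finally have "real (K + 1) * (cmod (\<sigma> M - \<sigma> K))\<^sup>2 \<le> (\<Sum>k=K..<M. (cmod (d k))\<^sup>2 / w k)"
      by (simp add: field_simps)
    moreover have "(\<Sum>k<K. (cmod (d k))\<^sup>2 / w k) + (\<Sum>k=K..<M. (cmod (d k))\<^sup>2 / w k)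
        = (\<Sum>k<M. (cmod (d k))\<^sup>2 / w k)"
      using that by (simp add: lessThan_atLeast0 sum.atLeastLessThan_concat)
    ultimately show ?thesis
      using D'[of M] by linarith
  qed
  have "Cauchy \<sigma>"
  proof (rule CauchyI')
    fix e :: real assume e: "0 < e"
    \<comment> \<open>From (m+1) |\<sigma>_n - \<sigma>_m|^2 at most D, any m with D < (m+1) e^2
      suffices.\<close>
    obtain N :: nat where N: "D / e\<^sup>2 < real N"
      using reals_Archimedean2 by blast
    show "\<exists>N. \<forall>m\<ge>N. \<forall>n>m. dist (\<sigma> m) (\<sigma> n) < e"
    proof (intro exI[of _ N] allI impI)
      fix m n assume mn: "N \<le> m" "m < n"
      have "0 \<le> (\<Sum>k<m. (cmod (d k))\<^sup>2 / w k)"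
        using w by (intro sum_nonneg) (simp add: less_imp_le)
      then have "real (m + 1) * (cmod (\<sigma> n - \<sigma> m))\<^sup>2 \<le> D"
        using tail[of m n] mn by linarith
      also have "D < real (m + 1) * e\<^sup>2"
      proof -
        have "D < real N * e\<^sup>2" using N e by (simp add: field_simps)
        also have "\<dots> \<le> real (m + 1) * e\<^sup>2" using mn by (intro mult_right_mono) auto
        finally show ?thesis .
      qed
      finally have "(cmod (\<sigma> n - \<sigma> m))\<^sup>2 < e\<^sup>2"
        by (simp add: mult_less_cancel_left_pos)
      then show "dist (\<sigma> m) (\<sigma> n) < e"
        using e by (metis dist_commute dist_norm power_less_imp_less_base less_imp_le)
    qed
  qed
  then obtain \<tau> where \<tau>: "\<sigma> \<longlonglongrightarrow> \<tau>"
    using Cauchy_convergent convergent_def by blast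
  have "(\<Sum>k\<le>K. (cmod (H k - \<tau>))\<^sup>2) \<le> D" for K
  proof -
    have sumS: "(\<Sum>i\<le>k. H i - \<tau>) = S k - of_nat (k + 1) * \<tau>" for k
      by (simp add: sum_subtractf S_def)
    \<comment> \<open>The limit of \<open>tail\<close> as M tends to infinity.\<close>
    have "real (K + 1) * (cmod (\<tau> - \<sigma> K))\<^sup>2 + (\<Sum>k<K. (cmod (d k))\<^sup>2 / w k) \<le> D"
    proof (rule tendsto_upperbound)
      show "(\<lambda>M. real (K + 1) * (cmod (\<sigma> M - \<sigma> K))\<^sup>2 + (\<Sum>k<K. (cmod (d k))\<^sup>2 / w k))
        \<longlonglongrightarrow> real (K + 1) * (cmod (\<tau> - \<sigma> K))\<^sup>2 + (\<Sum>k<K. (cmod (d k))\<^sup>2 / w k)"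
        by (intro tendsto_intros \<tau>)
      show "\<forall>\<^sub>F M in sequentially. real (K + 1) * (cmod (\<sigma> M - \<sigma> K))\<^sup>2
          + (\<Sum>k<K. (cmod (d k))\<^sup>2 / w k) \<le> D"
        using eventually_ge_at_top[of K] by eventually_elim (rule tail)
    qed simp
    \<comment> \<open>Subtracting a constant from H leaves every \<open>d k\<close> unchanged, so
      the telescoped identity for the shifted sequence has the same left side.\<close>
    moreover have "of_nat (k + 1) * (H (k + 1) - \<tau>) - (S k - of_nat (k + 1) * \<tau>) = d k" for k
      by (simp add: d_def algebra_simps)
    then have "(\<Sum>k<K. (cmod (d k))\<^sup>2 / w k)
      = (\<Sum>k\<le>K. (cmod (H k - \<tau>))\<^sup>2) - (cmod (S K - of_nat (K + 1) * \<tau>))\<^sup>2 / real (K + 1)"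
      using sum_cesaro_differences[of "\<lambda>k. H k - \<tau>" K] unfolding sumS by (simp add: w_def)
    moreover have "real (K + 1) * (cmod (\<tau> - \<sigma> K))\<^sup>2
        = (cmod (S K - of_nat (K + 1) * \<tau>))\<^sup>2 / real (K + 1)"
    proof -
      have "of_nat (K + 1) \<noteq> (0::complex)"
        unfolding of_nat_eq_0_iff by simp
      then have "S K - of_nat (K + 1) * \<tau> = - of_nat (K + 1) * (\<tau> - \<sigma> K)"
        by (simp add: \<sigma>_def field_simps)
      then have "cmod (S K - of_nat (K + 1) * \<tau>) = real (K + 1) * cmod (\<tau> - \<sigma> K)"
        by (simp only: norm_mult norm_minus_cancel norm_of_nat)
      then show ?thesis
        by (simp add: power_mult_distrib power2_eq_square)
    qed
    ultimately show ?thesis by linarith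
  qed
  then show ?thesis using that by blast
qed

subsection \<open>The local Dirichlet integral\<close>

lemma has_fps_expansion_disc:
  "f holomorphic_on ball 0 1 \<Longrightarrow> f has_fps_expansion fps_expansion f 0"
  by (rule has_fps_expansion_fps_expansion[of "ball 0 1"]) auto

lemma fps_expansion_eq_disc:
  assumes "f has_fps_expansion A" "\<And>z. z \<in> ball 0 1 \<Longrightarrow> g z = f z"
  shows "fps_expansion g 0 = A"
proof -
  have "eventually (\<lambda>z. z \<in> ball (0::complex) 1) (nhds 0)"
    by (intro eventually_nhds_in_open) auto
  then have "eventually (\<lambda>z. g z = f z) (nhds 0)"
    by eventually_elim (rule assms(2))
  then have "fps_expansion g 0 = fps_expansion f 0"
    by (rule fps_expansion_cong)
  then show ?thesis
    using fps_expansion_eqI[OF assms(1)] by simp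
qed

lemma fps_expansion_mult_linear:
  assumes h: "h holomorphic_on ball 0 1"
    and f: "\<And>z. z \<in> ball 0 1 \<Longrightarrow> f z = \<beta> + (z - l) * h z"
  shows "fps_nth (fps_expansion f 0) 0 = \<beta> - l * fps_nth (fps_expansion h 0) 0"
    and "fps_nth (fps_expansion f 0) (Suc k)
      = fps_nth (fps_expansion h 0) k - l * fps_nth (fps_expansion h 0) (Suc k)"
proof -
  have "fps_expansion f 0 = fps_const \<beta> + (fps_X - fps_const l) * fps_expansion h 0"
    by (rule fps_expansion_eq_disc[OF _ f])
       (intro fps_expansion_intros has_fps_expansion_disc[OF h])
  then show "fps_nth (fps_expansion f 0) 0 = \<beta> - l * fps_nth (fps_expansion h 0) 0"
    "fps_nth (fps_expansion f 0) (Suc k)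
      = fps_nth (fps_expansion h 0) k - l * fps_nth (fps_expansion h 0) (Suc k)"
    by (simp_all add: left_diff_distrib)
qed

text \<open>Let G be the coefficients of \<open>h\<close> and C those of f'/(z - l). Comparing
  coefficients in f' = (z - l) (f'/(z - l)) gives C_k - l C_{k+1} = (k+2) (G_{k+1} - l G_{k+2}).
  Powers of \<open>l\<close> turn this into a recursion solved by induction.\<close>

lemma power_mult_fps_expansion_deriv_quotient:
  assumes l: "cmod l = 1" and h: "h holomorphic_on ball 0 1"
    and f: "\<And>z. z \<in> ball 0 1 \<Longrightarrow> f z = \<beta> + (z - l) * h z"
  shows "l ^ (k + 1) * fps_nth (fps_expansion (\<lambda>z. deriv f z / (z - l)) 0) k
    = of_nat (k + 1) * (l ^ (k + 1) * fps_nth (fps_expansion h 0) (k + 1))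
      - (\<Sum>i\<le>k. l ^ i * fps_nth (fps_expansion h 0) i)"
proof -
  let ?C = "\<lambda>k. fps_nth (fps_expansion (\<lambda>z. deriv f z / (z - l)) 0) k"
  let ?G = "\<lambda>k. fps_nth (fps_expansion h 0) k"
  have zl: "z - l \<noteq> 0" if "z \<in> ball 0 1" for z
    using that l by auto
  have fh: "f holomorphic_on ball 0 1"
    by (rule holomorphic_transform[of "\<lambda>z. \<beta> + (z - l) * h z"]) (auto intro!: holomorphic_intros h simp: f)
  have Fh: "(\<lambda>z. deriv f z / (z - l)) holomorphic_on ball 0 1"
    using zl by (auto intro!: holomorphic_intros holomorphic_deriv fh)
  have deriv0: "fps_expansion (deriv f) 0 = fps_deriv (fps_expansion f 0)"
    by (rule fps_expansion_eqI) (intro fps_expansion_intros has_fps_expansion_disc[OF fh])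
  \<comment> \<open>With constant term 0, f' has the same shape as \<open>f\<close>, so one
    coefficient lemma serves for both.\<close>
  have df: "deriv f z = 0 + (z - l) * (deriv f z / (z - l))" if "z \<in> ball 0 1" for z
    using zl[OF that] by simp
  note C = fps_expansion_mult_linear[OF Fh df, unfolded deriv0]
  note A = fps_expansion_mult_linear[OF h f]
  show ?thesis
  proof (induction k)
    case 0
    have "- (l * ?C 0) = ?G 0 - l * ?G 1"
      using C(1) A(2)[of 0] by simp
    then show ?case by (simp add: algebra_simps)
  next
    case (Suc k)
    have eq: "?C k - l * ?C (Suc k) = of_nat (k + 2) * (?G (Suc k) - l * ?G (Suc (Suc k)))"
      using C(2)[of k] A(2)[of "Suc k"] by simp
    have "l ^ (k + 2) * ?C (Suc k) = l ^ (k + 1) * ?C k - l ^ (k + 1) * (?C k - l * ?C (Suc k))"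
      by (simp add: algebra_simps power2_eq_square)
    also have "\<dots> = l ^ (k + 1) * ?C k - l ^ (k + 1) * (of_nat (k + 2) * (?G (Suc k) - l * ?G (Suc (Suc k))))"
      by (simp only: eq)
    also have "\<dots> = of_nat (k + 1) * (l ^ (k + 1) * ?G (k + 1)) - (\<Sum>i\<le>k. l ^ i * ?G i)
        - l ^ (k + 1) * (of_nat (k + 2) * (?G (Suc k) - l * ?G (Suc (Suc k))))"
      by (simp only: Suc.IH)
    also have "\<dots> = of_nat (Suc k + 1) * (l ^ (Suc k + 1) * ?G (Suc k + 1)) - (\<Sum>i\<le>Suc k. l ^ i * ?G i)"
      by (simp add: algebra_simps)
    finally show ?case by simp
  qed
qed

section \<open>The local Dirichlet integral against the Hardy norm of the quotient\<close>

lemma hardy_norm_sq_eq_twisted: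
  assumes "cmod l = 1"
  shows "hardy_norm_sq h = (\<Sum>k. ennreal ((cmod (l ^ k * fps_nth (fps_expansion h 0) k))\<^sup>2))"
  using assms by (simp add: hardy_norm_sq_def norm_mult norm_power)

lemma suminf_ennreal_le:
  assumes "\<And>K. (\<Sum>k<K. x k) \<le> D" "\<And>k. 0 \<le> x k"
  shows "(\<Sum>k. ennreal (x k)) \<le> ennreal D"
  unfolding suminf_eq_SUP using assms by (intro SUP_least) (simp add: sum_ennreal ennreal_leI)

lemma sum_ennreal_le_suminf:
  assumes "\<And>k. 0 \<le> x k"
  shows "ennreal (\<Sum>k<K. x k) \<le> (\<Sum>k. ennreal (x k))"
proof -
  have "ennreal (\<Sum>k<K. x k) = (\<Sum>k<K. ennreal (x k))"
    using assms by simp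
  also have "\<dots> \<le> (\<Sum>k. ennreal (x k))"
    by (rule sum_le_suminf) auto
  finally show ?thesis .
qed

definition local_dirichlet_integral :: "complex \<Rightarrow> (complex \<Rightarrow> complex) \<Rightarrow> ennreal" where
  "local_dirichlet_integral l f
    = (\<integral>\<^sup>+z. ennreal ((cmod (deriv f z))\<^sup>2 * ((1 - (cmod z)\<^sup>2) / (cmod (l - z))\<^sup>2)) \<partial>disc_area)"

text \<open>The kernel's denominator is absorbed into F = f'/(z - l), and the weighted Parseval
  identity applies to F. Since |l| = 1, its coefficients may be multiplied by powers of
  \<open>l\<close> without changing their moduli.\<close>

lemma local_dirichlet_integral_series:
  assumes l: "cmod l = 1" and h: "h holomorphic_on ball 0 1"
    and f: "\<And>z. z \<in> ball 0 1 \<Longrightarrow> f z = \<beta> + (z - l) * h z"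
  defines "H \<equiv> \<lambda>k. l ^ k * fps_nth (fps_expansion h 0) k"
  shows "local_dirichlet_integral l f = (\<Sum>k. ennreal ((cmod (of_nat (k + 1) * H (k + 1) - (\<Sum>i\<le>k. H i)))\<^sup>2
      / (real (k + 1) * real (k + 2))))"
proof -
  have fh: "f holomorphic_on ball 0 1"
    by (rule holomorphic_transform[of "\<lambda>z. \<beta> + (z - l) * h z"]) (auto intro!: holomorphic_intros h simp: f)
  have zl: "z - l \<noteq> 0" if "z \<in> ball 0 1" for z
    using that l by auto
  have Fh: "(\<lambda>z. deriv f z / (z - l)) holomorphic_on ball 0 1"
    using zl by (auto intro!: holomorphic_intros holomorphic_deriv fh)
  have "local_dirichlet_integral l f
      = (\<integral>\<^sup>+z. ennreal ((cmod (deriv f z / (z - l)))\<^sup>2 * (1 - (cmod z)\<^sup>2)) \<partial>disc_area)"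
    unfolding local_dirichlet_integral_def
    by (simp add: norm_divide power_divide norm_minus_commute)
  also have "\<dots> = (\<Sum>k. ennreal ((cmod (fps_nth (fps_expansion (\<lambda>z. deriv f z / (z - l)) 0) k))\<^sup>2
      / (real (k + 1) * real (k + 2))))"
    by (rule nn_integral_weighted_disc_area[OF Fh])
  moreover have "cmod (fps_nth (fps_expansion (\<lambda>z. deriv f z / (z - l)) 0) k)
      = cmod (of_nat (k + 1) * H (k + 1) - (\<Sum>i\<le>k. H i))" for k
  proof -
    have "cmod (fps_nth (fps_expansion (\<lambda>z. deriv f z / (z - l)) 0) k)
      = cmod (l ^ (k + 1) * fps_nth (fps_expansion (\<lambda>z. deriv f z / (z - l)) 0) k)"
      using l by (simp add: norm_mult norm_power)
    also have "\<dots> = cmod (of_nat (k + 1) * H (k + 1) - (\<Sum>i\<le>k. H i))"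
      unfolding H_def by (simp only: power_mult_fps_expansion_deriv_quotient[OF l h f])
    finally show ?thesis .
  qed
  ultimately show ?thesis by simp
qed

text \<open>In \<open>sum_cesaro_differences\<close> the subtracted square is nonnegative, so each
  partial sum of the series is at most a partial sum for the Hardy norm.\<close>

lemma local_dirichlet_integral_le_hardy_norm_sq:
  assumes l: "cmod l = 1" and h: "h holomorphic_on ball 0 1"
    and f: "\<And>z. z \<in> ball 0 1 \<Longrightarrow> f z = \<beta> + (z - l) * h z"
  shows "local_dirichlet_integral l f \<le> hardy_norm_sq h"
proof -
  define H where "H k = l ^ k * fps_nth (fps_expansion h 0) k" for k
  have "(\<Sum>k<K. ennreal ((cmod (of_nat (k + 1) * H (k + 1) - (\<Sum>i\<le>k. H i)))\<^sup>2
      / (real (k + 1) * real (k + 2)))) \<le> (\<Sum>k. ennreal ((cmod (H k))\<^sup>2))" for K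
  proof -
    have "(\<Sum>k<K. (cmod (of_nat (k + 1) * H (k + 1) - (\<Sum>i\<le>k. H i)))\<^sup>2 / (real (k + 1) * real (k + 2)))
        \<le> (\<Sum>k<Suc K. (cmod (H k))\<^sup>2)"
      unfolding sum_cesaro_differences lessThan_Suc_atMost by simp
    then have "ennreal (\<Sum>k<K. (cmod (of_nat (k + 1) * H (k + 1) - (\<Sum>i\<le>k. H i)))\<^sup>2 / (real (k + 1) * real (k + 2)))
        \<le> ennreal (\<Sum>k<Suc K. (cmod (H k))\<^sup>2)"
      by (rule ennreal_leI)
    also have "\<dots> \<le> (\<Sum>k. ennreal ((cmod (H k))\<^sup>2))"
      by (rule sum_ennreal_le_suminf) simp
    finally show ?thesis
      by (subst sum_ennreal) auto
  qed
  note partial = this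
  have "local_dirichlet_integral l f = (\<Sum>k. ennreal ((cmod (of_nat (k + 1) * H (k + 1) - (\<Sum>i\<le>k. H i)))\<^sup>2
      / (real (k + 1) * real (k + 2))))"
    unfolding H_def by (rule local_dirichlet_integral_series[OF l h f])
  also have "\<dots> \<le> (\<Sum>k. ennreal ((cmod (H k))\<^sup>2))"
    by (subst suminf_eq_SUP) (rule SUP_least, rule partial)
  also have "\<dots> = hardy_norm_sq h"
    unfolding H_def by (rule hardy_norm_sq_eq_twisted[OF l, symmetric])
  finally show ?thesis .
qed

text \<open>The series for the local integral is finite for the quotient with constant 0. Changing
  the constant shifts all twisted coefficients by one number, and
  \<open>square_summable_shift\<close> supplies the right shift.\<close>

lemma local_dirichlet_decomposition:
  assumes l: "cmod l = 1" and fh: "f holomorphic_on ball 0 1"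
    and fin: "local_dirichlet_integral l f < \<infinity>"
  obtains \<beta> h where "h holomorphic_on ball 0 1"
    "\<And>z. z \<in> ball 0 1 \<Longrightarrow> f z = \<beta> + (z - l) * h z"
    "hardy_norm_sq h \<le> local_dirichlet_integral l f"
    "ennreal ((cmod \<beta>)\<^sup>2) \<le> 2 * hardy_norm_sq f + 2 * hardy_norm_sq h"
proof -
  have zl: "z \<noteq> l" if "z \<in> ball 0 1" for z
    using that l by auto
  define q where "q = (\<lambda>\<beta> z. (f z - \<beta>) / (z - l))"
  have qh: "q \<beta> holomorphic_on ball 0 1" for \<beta>
    unfolding q_def using zl by (auto intro!: holomorphic_intros fh)
  have fq: "f z = \<beta> + (z - l) * q \<beta> z" if "z \<in> ball 0 1" for z \<beta>
    using zl[OF that] by (simp add: q_def)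
  define H where "H \<beta> k = l ^ k * fps_nth (fps_expansion (q \<beta>) 0) k" for \<beta> k
  have ser: "local_dirichlet_integral l f = (\<Sum>k. ennreal ((cmod (of_nat (k + 1) * H \<beta> (k + 1)
      - (\<Sum>i\<le>k. H \<beta> i)))\<^sup>2 / (real (k + 1) * real (k + 2))))" for \<beta>
    unfolding H_def by (rule local_dirichlet_integral_series[OF l qh fq])
  define D where "D = enn2real (local_dirichlet_integral l f)"
  have D: "local_dirichlet_integral l f = ennreal D" "0 \<le> D"
    using fin by (simp_all add: D_def)
  have "(\<Sum>k<K. (cmod (of_nat (k + 1) * H 0 (k + 1) - (\<Sum>i\<le>k. H 0 i)))\<^sup>2
      / (real (k + 1) * real (k + 2))) \<le> D" for K
  proof -
    have "ennreal (\<Sum>k<K. (cmod (of_nat (k + 1) * H 0 (k + 1) - (\<Sum>i\<le>k. H 0 i)))\<^sup>2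
      / (real (k + 1) * real (k + 2))) \<le> ennreal D"
      unfolding D(1)[symmetric] ser[of 0] by (rule sum_ennreal_le_suminf) simp
    then show ?thesis using D(2) by simp
  qed
  from square_summable_shift[OF this] obtain \<tau> where \<tau>: "\<And>K. (\<Sum>k\<le>K. (cmod (H 0 k - \<tau>))\<^sup>2) \<le> D"
    by metis
  \<comment> \<open>The function -\<beta>/(z - l) has all twisted coefficients equal to \<beta>/l,
    so this choice subtracts \<tau> from each of them.\<close>
  define \<beta> where "\<beta> = - \<tau> * l"
  have H: "H \<beta> k = H 0 k - \<tau>" for k
  proof (induction k)
    case 0
    have "\<beta> - l * H \<beta> 0 = - (l * H 0 0)"
      using fps_expansion_mult_linear(1)[OF qh fq, of \<beta>] fps_expansion_mult_linear(1)[OF qh fq, of 0]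
      by (simp add: H_def)
    then have "l * H \<beta> 0 = l * (H 0 0 - \<tau>)"
      by (simp add: \<beta>_def algebra_simps)
    moreover have "l \<noteq> 0" using l by auto
    ultimately show ?case by simp
  next
    case (Suc k)
    have "l ^ k * (fps_nth (fps_expansion (q \<beta>) 0) k - l * fps_nth (fps_expansion (q \<beta>) 0) (Suc k))
        = l ^ k * (fps_nth (fps_expansion (q 0) 0) k - l * fps_nth (fps_expansion (q 0) 0) (Suc k))"
      using fps_expansion_mult_linear(2)[OF qh fq, of k \<beta>] fps_expansion_mult_linear(2)[OF qh fq, of k 0]
      by simp
    then have "H \<beta> k - H \<beta> (Suc k) = H 0 k - H 0 (Suc k)"
      by (simp add: H_def algebra_simps)
    then show ?case using Suc.IH by (simp add: algebra_simps)
  qed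
  \<comment> \<open>The bound for \<tau> concerns sums over k \<le> K, hence the index K - 1; the
    empty sum is covered by 0 \<le> D.\<close>
  have "(\<Sum>k<K. (cmod (H \<beta> k))\<^sup>2) \<le> D" for K
    using \<tau>[of "K - 1"] D(2) by (cases K) (simp_all add: H lessThan_Suc_atMost)
  then have "hardy_norm_sq (q \<beta>) \<le> local_dirichlet_integral l f"
    unfolding hardy_norm_sq_eq_twisted[OF l, of "q \<beta>"] D(1) H_def by (rule suminf_ennreal_le) simp
  moreover have "ennreal ((cmod \<beta>)\<^sup>2) \<le> 2 * hardy_norm_sq f + 2 * hardy_norm_sq (q \<beta>)"
  proof -
    let ?a = "fps_nth (fps_expansion f 0) 0" and ?b = "fps_nth (fps_expansion (q \<beta>) 0) 0"
    \<comment> \<open>The decomposition evaluated at the origin bounds \<beta> by two constant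
      coefficients, each controlled by a Hardy norm.\<close>
    have "\<beta> = ?a + l * ?b"
      using fps_expansion_mult_linear(1)[OF qh fq, of \<beta>] by simp
    then have "cmod \<beta> \<le> cmod ?a + cmod ?b"
      using norm_triangle_ineq[of ?a "l * ?b"] l by (simp add: norm_mult)
    then have "(cmod \<beta>)\<^sup>2 \<le> (cmod ?a + cmod ?b)\<^sup>2"
      by (intro power_mono) auto
    also have "\<dots> \<le> 2 * (cmod ?a)\<^sup>2 + 2 * (cmod ?b)\<^sup>2"
      by (use sum_squares_bound[of "cmod ?a" "cmod ?b"] in \<open>simp add: power2_sum\<close>)
    finally have "ennreal ((cmod \<beta>)\<^sup>2) \<le> ennreal (2 * (cmod ?a)\<^sup>2 + 2 * (cmod ?b)\<^sup>2)"
      by (rule ennreal_leI)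
    also have "\<dots> = 2 * ennreal ((cmod ?a)\<^sup>2) + 2 * ennreal ((cmod ?b)\<^sup>2)"
      by (simp add: ennreal_mult')
    also have "\<dots> \<le> 2 * hardy_norm_sq f + 2 * hardy_norm_sq (q \<beta>)"
    proof -
      have "(\<Sum>k\<in>{0}. ennreal ((cmod (fps_nth (fps_expansion g 0) k))\<^sup>2)) \<le> hardy_norm_sq g" for g
        unfolding hardy_norm_sq_def by (rule sum_le_suminf) auto
      then have le: "ennreal ((cmod (fps_nth (fps_expansion g 0) 0))\<^sup>2) \<le> hardy_norm_sq g" for g
        by simp
      show ?thesis by (intro add_mono mult_left_mono le) simp_all
    qed
    finally show ?thesis .
  qed
  ultimately show ?thesis
    using that[OF qh fq] by blast
qed

subsection \<open>Products, sums and partial fractions\<close>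

lemma norm_add_sq_le: "(norm (a + b))\<^sup>2 \<le> 2 * (norm a)\<^sup>2 + 2 * (norm b)\<^sup>2"
proof -
  have "(norm (a + b))\<^sup>2 \<le> (norm a + norm b)\<^sup>2"
    by (intro power_mono norm_triangle_ineq) auto
  also have "\<dots> \<le> 2 * (norm a)\<^sup>2 + 2 * (norm b)\<^sup>2"
    using sum_squares_bound[of "norm a" "norm b"] by (simp add: power2_sum)
  finally show ?thesis .
qed

lemma norm_sum_mult_sq_le:
  fixes w x :: "'a \<Rightarrow> complex"
  shows "(cmod (\<Sum>j\<in>J. w j * x j))\<^sup>2 \<le> real (card J) * (\<Sum>j\<in>J. (cmod (w j))\<^sup>2 * (cmod (x j))\<^sup>2)"
proof -
  have "(cmod (\<Sum>j\<in>J. w j * x j))\<^sup>2 \<le> (\<Sum>j\<in>J. cmod (w j * x j))\<^sup>2"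
    by (intro power_mono norm_sum) auto
  also have "\<dots> \<le> (\<Sum>j\<in>J. (cmod (w j * x j))\<^sup>2) * card J"
    by (rule sum_squared_le_sum_of_squares)
  finally show ?thesis
    by (simp add: norm_mult power_mult_distrib mult.commute)
qed

lemma suminf_ennreal_Suc:
  fixes x :: "nat \<Rightarrow> ennreal"
  shows "(\<Sum>k. x k) = (\<Sum>k. x (Suc k)) + x 0"
  using sums_Suc[OF summable_sums[OF summableI], of x] by (rule sums_unique[symmetric])

text \<open>The factor 4 reflects |z - l| \<le> 2, but is obtained from coefficients: each new one
  is a difference of two old ones of unimodular weight, up to sign in degree 0.\<close>

lemma hardy_norm_sq_mult_linear:
  assumes l: "cmod l = 1" and h: "h holomorphic_on ball 0 1"
  shows "hardy_norm_sq (\<lambda>z. (z - l) * h z) \<le> 4 * hardy_norm_sq h"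
proof -
  let ?f = "\<lambda>z. (z - l) * h z"
  define A where "A k = ennreal ((cmod (fps_nth (fps_expansion ?f 0) k))\<^sup>2)" for k
  define G where "G k = ennreal ((cmod (fps_nth (fps_expansion h 0) k))\<^sup>2)" for k
  have f: "?f z = 0 + (z - l) * h z" for z by simp
  note coeff = fps_expansion_mult_linear[OF h f]
  \<comment> \<open>The sharper \<open>A 0 = G 0\<close> is relaxed so that 2 G_0 completes the
    shifted series to a full Hardy norm.\<close>
  have A0: "A 0 \<le> 2 * G 0"
  proof -
    have "A 0 = G 0"
      unfolding A_def G_def coeff(1) using l by (simp add: norm_mult)
    then show ?thesis by (simp add: mult_2)
  qed
  have AS: "A (Suc k) \<le> 2 * G k + 2 * G (Suc k)" for k
  proof -
    let ?g = "\<lambda>k. fps_nth (fps_expansion h 0) k"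
    have "(cmod (?g k - l * ?g (Suc k)))\<^sup>2 \<le> 2 * (cmod (?g k))\<^sup>2 + 2 * (cmod (?g (Suc k)))\<^sup>2"
      using norm_add_sq_le[of "?g k" "- l * ?g (Suc k)"] l by (simp add: norm_mult)
    then have "A (Suc k) \<le> ennreal (2 * (cmod (?g k))\<^sup>2 + 2 * (cmod (?g (Suc k)))\<^sup>2)"
      unfolding A_def coeff(2) by (rule ennreal_leI)
    then show ?thesis by (simp add: G_def ennreal_mult')
  qed
  have "hardy_norm_sq ?f = (\<Sum>k. A (Suc k)) + A 0"
    unfolding hardy_norm_sq_def A_def by (rule suminf_ennreal_Suc)
  also have "\<dots> \<le> (\<Sum>k. 2 * G k + 2 * G (Suc k)) + 2 * G 0"
    by (intro add_mono suminf_le AS A0 summableI)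
  also have "(\<Sum>k. 2 * G k + 2 * G (Suc k)) = 2 * (\<Sum>k. G k) + 2 * (\<Sum>k. G (Suc k))"
    by (subst suminf_add[symmetric]) (simp_all add: summableI)
  also have "\<dots> + 2 * G 0 = 2 * (\<Sum>k. G k) + 2 * ((\<Sum>k. G (Suc k)) + G 0)"
    by (simp only: distrib_left add.assoc)
  also have "\<dots> = 2 * (\<Sum>k. G k) + 2 * (\<Sum>k. G k)"
    by (simp only: suminf_ennreal_Suc[of G, symmetric])
  also have "\<dots> = 4 * hardy_norm_sq h"
    unfolding hardy_norm_sq_def G_def by (simp flip: distrib_right)
  finally show ?thesis .
qed

lemma hardy_norm_sq_mult_prod:
  assumes "finite J" and "\<And>j. j \<in> J \<Longrightarrow> cmod (l j) = 1" and h: "h holomorphic_on ball 0 1"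
  shows "hardy_norm_sq (\<lambda>z. (\<Prod>j\<in>J. z - l j) * h z) \<le> 4 ^ card J * hardy_norm_sq h"
  using assms(1,2)
proof (induction J rule: finite_induct)
  case (insert a J)
  have "hardy_norm_sq (\<lambda>z. (\<Prod>j\<in>insert a J. z - l j) * h z)
      = hardy_norm_sq (\<lambda>z. (z - l a) * ((\<Prod>j\<in>J. z - l j) * h z))"
    using insert by (simp add: mult.assoc)
  also have "\<dots> \<le> 4 * hardy_norm_sq (\<lambda>z. (\<Prod>j\<in>J. z - l j) * h z)"
    using insert by (intro hardy_norm_sq_mult_linear holomorphic_intros h) auto
  also have "\<dots> \<le> 4 * (4 ^ card J * hardy_norm_sq h)"
    using insert by (intro mult_left_mono) auto
  also have "\<dots> = 4 ^ card (insert a J) * hardy_norm_sq h"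
    using insert by (simp add: mult.assoc)
  finally show ?case .
qed simp

text \<open>Cauchy-Schwarz over the index set, applied to each Taylor coefficient
  separately.\<close>

lemma hardy_norm_sq_sum:
  assumes h: "\<And>j. j \<in> J \<Longrightarrow> h j holomorphic_on ball 0 1"
  shows "hardy_norm_sq (\<lambda>z. \<Sum>j\<in>J. w j * h j z)
    \<le> ennreal (real (card J)) * (\<Sum>j\<in>J. ennreal ((cmod (w j))\<^sup>2) * hardy_norm_sq (h j))"
proof -
  let ?G = "\<lambda>j k. fps_nth (fps_expansion (h j) 0) k"
  have "fps_expansion (\<lambda>z. \<Sum>j\<in>J. w j * h j z) 0 = (\<Sum>j\<in>J. fps_const (w j) * fps_expansion (h j) 0)"
    by (intro fps_expansion_eqI fps_expansion_intros has_fps_expansion_disc h)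
  then have coeff: "fps_nth (fps_expansion (\<lambda>z. \<Sum>j\<in>J. w j * h j z) 0) k = (\<Sum>j\<in>J. w j * ?G j k)" for k
    by (simp add: fps_sum_nth)
  have "ennreal ((cmod (\<Sum>j\<in>J. w j * ?G j k))\<^sup>2)
      \<le> ennreal (real (card J)) * (\<Sum>j\<in>J. ennreal ((cmod (w j))\<^sup>2) * ennreal ((cmod (?G j k))\<^sup>2))" for k
    using ennreal_leI[OF norm_sum_mult_sq_le[of w "\<lambda>j. ?G j k" J]]
    by (simp add: ennreal_mult' flip: sum_ennreal)
  then have "hardy_norm_sq (\<lambda>z. \<Sum>j\<in>J. w j * h j z)
      \<le> (\<Sum>k. ennreal (real (card J)) * (\<Sum>j\<in>J. ennreal ((cmod (w j))\<^sup>2) * ennreal ((cmod (?G j k))\<^sup>2)))"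
    unfolding hardy_norm_sq_def coeff by (intro suminf_le summableI)
  also have "\<dots> = ennreal (real (card J)) * (\<Sum>j\<in>J. ennreal ((cmod (w j))\<^sup>2) * hardy_norm_sq (h j))"
    unfolding hardy_norm_sq_def by (simp add: suminf_sum summableI)
  finally show ?thesis .
qed

lemma partial_fraction_decomposition:
  fixes l :: "'a \<Rightarrow> complex"
  assumes "finite J" "J \<noteq> {}" "inj_on l J"
  obtains w where "\<And>z. z \<notin> l ` J \<Longrightarrow> 1 / (\<Prod>j\<in>J. z - l j) = (\<Sum>j\<in>J. w j / (z - l j))"
proof -
  have "\<exists>w. \<forall>z. z \<notin> l ` J \<longrightarrow> 1 / (\<Prod>j\<in>J. z - l j) = (\<Sum>j\<in>J. w j / (z - l j))"
    using assms
  proof (induction rule: finite_ne_induct)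
    case (singleton a)
    show ?case by (rule exI[of _ "\<lambda>_. 1"]) simp
  next
    case (insert a J)
    then obtain w where w: "\<And>z. z \<notin> l ` J \<Longrightarrow> 1 / (\<Prod>j\<in>J. z - l j) = (\<Sum>j\<in>J. w j / (z - l j))"
      by auto
    \<comment> \<open>From 1/((z - l_j)(z - l_a)) = (1/(z - l_j) - 1/(z - l_a)) / (l_j - l_a): each
      old pole keeps a rescaled coefficient, and the new pole collects the negative
      contributions.\<close>
    define v where "v = (\<lambda>j. if j = a then - (\<Sum>i\<in>J. w i / (l i - l a)) else w j / (l j - l a))"
    have "1 / (\<Prod>j\<in>insert a J. z - l j) = (\<Sum>j\<in>insert a J. v j / (z - l j))" if z: "z \<notin> l ` insert a J" for z
    proof -
      have "1 / (\<Prod>j\<in>insert a J. z - l j) = (\<Sum>j\<in>J. w j / (z - l j)) / (z - l a)"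
        using insert w[of z] z by (simp add: divide_simps)
      also have "\<dots> = (\<Sum>j\<in>J. v j / (z - l j) - w j / (l j - l a) / (z - l a))"
        unfolding sum_divide_distrib
      proof (rule sum.cong[OF refl])
        fix j assume j: "j \<in> J"
        then have "j \<noteq> a" "l j - l a \<noteq> 0" "z - l j \<noteq> 0" "z - l a \<noteq> 0"
          using insert.hyps insert.prems z by (auto simp: inj_on_def)
        then show "w j / (z - l j) / (z - l a) = v j / (z - l j) - w j / (l j - l a) / (z - l a)"
          by (simp add: v_def divide_simps) (simp add: algebra_simps)
      qed
      also have "\<dots> = (\<Sum>j\<in>insert a J. v j / (z - l j))"
        using insert.hyps by (simp add: sum_subtractf v_def sum_divide_distrib)
      finally show ?thesis .
    qed
    then show ?case by blast
  qed
  then show ?thesis using that by blast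
qed

subsection \<open>The Dirichlet integral for a finitely supported measure\<close>

text \<open>The measure is the image under \<open>l\<close> of the weighted counting measure on the
  indices, which turns the integral into a finite sum.\<close>

lemma nn_integral_point_mass_sum:
  assumes l: "\<And>j. j \<in> {1..n} \<Longrightarrow> l j \<in> sphere 0 1"
    and g: "g \<in> borel_measurable circle_borel"
  shows "(\<integral>\<^sup>+\<zeta>. g \<zeta> \<partial>point_mass_sum n \<alpha> l) = (\<Sum>j=1..n. ennreal (\<alpha> j) * g (l j))"
proof -
  let ?M = "point_measure {1..n} (\<lambda>j. ennreal (\<alpha> j))"
  have lm: "l \<in> measurable ?M circle_borel"
    using l by (auto simp: measurable_point_measure_eq1 circle_borel_def space_restrict_space)
  have eq: "point_mass_sum n \<alpha> l = distr ?M circle_borel l"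
  proof (rule measure_eqI)
    fix A assume "A \<in> sets (point_mass_sum n \<alpha> l)"
    then have A: "A \<in> sets circle_borel" by simp
    have "emeasure (distr ?M circle_borel l) A = (\<Sum>j\<in>l -` A \<inter> {1..n}. ennreal (\<alpha> j))"
      unfolding emeasure_distr[OF lm A] space_point_measure by (rule emeasure_point_measure_finite) auto
    also have "\<dots> = (\<Sum>j=1..n. ennreal (\<alpha> j) * indicator A (l j))"
      by (rule sum.mono_neutral_cong_left) (auto simp: indicator_def)
    finally show "emeasure (point_mass_sum n \<alpha> l) A = emeasure (distr ?M circle_borel l) A"
      using A by (simp add: emeasure_point_mass_sum)
  qed simp
  show ?thesis
    unfolding eq using g by (subst nn_integral_distr[OF lm]) (simp_all add: nn_integral_point_measure_finite)
qed

lemma poisson_integral_point_mass_sum: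
  assumes l: "\<And>j. j \<in> {1..n} \<Longrightarrow> l j \<in> sphere 0 1"
  shows "poisson_integral (point_mass_sum n \<alpha> l) z
    = (\<Sum>j=1..n. ennreal (\<alpha> j) * ennreal ((1 - (cmod z)\<^sup>2) / (cmod (l j - z))\<^sup>2))"
  unfolding poisson_integral_def
  by (rule nn_integral_point_mass_sum[OF l]) (simp_all add: circle_borel_def measurable_restrict_space1)

lemma dirichlet_integral_point_mass_sum:
  assumes l: "\<And>j. j \<in> {1..n} \<Longrightarrow> l j \<in> sphere 0 1" and f: "f holomorphic_on ball 0 1"
  shows "dirichlet_integral (point_mass_sum n \<alpha> l) f
    = (\<Sum>j=1..n. ennreal (\<alpha> j) * local_dirichlet_integral (l j) f)"
proof -
  let ?k = "\<lambda>j z. ennreal ((cmod (deriv f z))\<^sup>2 * ((1 - (cmod z)\<^sup>2) / (cmod (l j - z))\<^sup>2))"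
  have "continuous_on (ball 0 1) (deriv f)"
    by (intro holomorphic_on_imp_continuous_on holomorphic_deriv f) auto
  then have "(\<lambda>z. (cmod (deriv f z))\<^sup>2) \<in> borel_measurable (restrict_space borel (ball 0 1))"
    by (intro borel_measurable_continuous_on_restrict continuous_intros)
  moreover have "(\<lambda>z. (1 - (cmod z)\<^sup>2) / (cmod (l j - z))\<^sup>2) \<in> borel_measurable (restrict_space borel (ball 0 1))" for j
    by (intro measurable_restrict_space1) measurable
  ultimately have km: "?k j \<in> borel_measurable disc_area" for j
    unfolding measurable_cong_sets[OF sets_disc_area refl]
    by (intro measurable_compose[OF _ measurable_ennreal] borel_measurable_times)
  have pt: "ennreal ((cmod (deriv f z))\<^sup>2) * poisson_integral (point_mass_sum n \<alpha> l) z
      = (\<Sum>j=1..n. ennreal (\<alpha> j) * ?k j z)" for z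
  proof -
    have "ennreal ((cmod (deriv f z))\<^sup>2) * (ennreal (\<alpha> j) * ennreal ((1 - (cmod z)\<^sup>2) / (cmod (l j - z))\<^sup>2))
        = ennreal (\<alpha> j) * ?k j z" for j
      by (subst ennreal_mult'[where a = "(cmod (deriv f z))\<^sup>2"]) (simp_all add: mult.left_commute)
    then show ?thesis
      by (simp only: poisson_integral_point_mass_sum[OF l] sum_distrib_left)
  qed
  have "dirichlet_integral (point_mass_sum n \<alpha> l) f = (\<integral>\<^sup>+z. (\<Sum>j=1..n. ennreal (\<alpha> j) * ?k j z) \<partial>disc_area)"
    unfolding dirichlet_integral_def by (simp only: pt)
  also have "\<dots> = (\<Sum>j=1..n. ennreal (\<alpha> j) * local_dirichlet_integral (l j) f)"
    unfolding local_dirichlet_integral_def using km by (simp add: nn_integral_sum nn_integral_cmult)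
  finally show ?thesis .
qed

subsection \<open>The Carleson conditions\<close>

lemma borel_measurable_holomorphic_cmod_sq:
  assumes "sets \<nu> = sets disc_borel" "f holomorphic_on ball 0 1"
  shows "(\<lambda>z. ennreal ((cmod (f z))\<^sup>2)) \<in> borel_measurable \<nu>"
  unfolding measurable_cong_sets[OF assms(1) refl] disc_borel_def
  using holomorphic_on_imp_continuous_on[OF assms(2)]
  by (intro measurable_compose[OF _ measurable_ennreal] borel_measurable_continuous_on_restrict continuous_intros)

text \<open>The density is |p|^2 for p = \<Prod>(z - l_j), so testing the weighted measure on
  \<open>g\<close> amounts to testing \<nu> on p g.\<close>

lemma nn_integral_density_prod:
  assumes \<nu>: "sets \<nu> = sets disc_borel" and g: "g holomorphic_on ball 0 1"
  shows "(\<integral>\<^sup>+z. ennreal ((cmod (g z))\<^sup>2) \<partial>density \<nu> (\<lambda>z. ennreal (\<Prod>j\<in>J. (cmod (z - l j))\<^sup>2)))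
    = (\<integral>\<^sup>+z. ennreal ((cmod ((\<Prod>j\<in>J. z - l j) * g z))\<^sup>2) \<partial>\<nu>)"
proof -
  have w: "ennreal (\<Prod>j\<in>J. (cmod (z - l j))\<^sup>2) = ennreal ((cmod (\<Prod>j\<in>J. z - l j))\<^sup>2)" for z
    by (simp add: prod_norm[symmetric] prod_power_distrib)
  have "(\<lambda>z. \<Prod>j\<in>J. z - l j) holomorphic_on ball 0 1"
    by (intro holomorphic_intros)
  from borel_measurable_holomorphic_cmod_sq[OF \<nu> this] borel_measurable_holomorphic_cmod_sq[OF \<nu> g]
  show ?thesis
    unfolding w by (subst nn_integral_density) (simp_all add: norm_mult power_mult_distrib ennreal_mult)
qed

text \<open>Test the Dirichlet condition on f = p g with \<open>g\<close> in the Hardy space.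
  Dividing \<open>f\<close> by one factor z - l_j leaves a Hardy function whose norm bounds the
  local integral at l_j.\<close>

lemma carleson_hardy_of_dirichlet:
  assumes l: "\<And>j. j \<in> {1..n} \<Longrightarrow> l j \<in> sphere 0 1"
    and \<nu>: "sets \<nu> = sets disc_borel"
    and C: "carleson_measure (dirichlet_space (point_mass_sum n \<alpha> l)) (dirichlet_norm_sq (point_mass_sum n \<alpha> l)) \<nu>"
  shows "carleson_measure hardy_space hardy_norm_sq
      (density \<nu> (\<lambda>z. ennreal (\<Prod>j=1..n. (cmod (z - l j))\<^sup>2)))"
proof -
  let ?\<mu> = "point_mass_sum n \<alpha> l"
  from C obtain C where C: "C > 0" "\<And>f. f \<in> dirichlet_space ?\<mu> \<Longrightarrow>
      (\<integral>\<^sup>+z. ennreal ((cmod (f z))\<^sup>2) \<partial>\<nu>) \<le> ennreal C * dirichlet_norm_sq ?\<mu> f"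
    unfolding carleson_measure_def by blast
  have l': "cmod (l j) = 1" if "j \<in> {1..n}" for j
    using l[OF that] by simp
  \<comment> \<open>The first summand bounds the Hardy part of the norm of \<open>f\<close>, the
    others its Dirichlet part. \<open>max 0\<close> matches \<open>ennreal\<close>, which sends
    negative weights to 0.\<close>
  define B where "B = 4 ^ n + (\<Sum>j=1..n. max 0 (\<alpha> j) * 4 ^ n)"
  have B: "B > 0"
    unfolding B_def by (intro add_pos_nonneg sum_nonneg) auto
  have bound: "(\<integral>\<^sup>+z. ennreal ((cmod (g z))\<^sup>2) \<partial>density \<nu> (\<lambda>z. ennreal (\<Prod>j=1..n. (cmod (z - l j))\<^sup>2)))
      \<le> ennreal (C * B) * hardy_norm_sq g" if g: "g \<in> hardy_space" for g
  proof -
    have gh: "g holomorphic_on ball 0 1" and gfin: "hardy_norm_sq g < \<infinity>"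
      using g by (auto simp: hardy_space_def)
    define f where "f = (\<lambda>z. (\<Prod>j\<in>{1..n}. z - l j) * g z)"
    have fh: "f holomorphic_on ball 0 1"
      unfolding f_def by (intro holomorphic_intros gh)
    have hf: "hardy_norm_sq f \<le> 4 ^ n * hardy_norm_sq g"
      using hardy_norm_sq_mult_prod[of "{1..n}" l g] l' gh by (simp add: f_def)
    have loc: "local_dirichlet_integral (l j) f \<le> 4 ^ n * hardy_norm_sq g" if j: "j \<in> {1..n}" for j
    proof -
      let ?h = "\<lambda>z. (\<Prod>i\<in>{1..n} - {j}. z - l i) * g z"
      have "f z = 0 + (z - l j) * ?h z" for z
        unfolding f_def using prod.remove[OF _ j, of "\<lambda>i. z - l i"] by simp
      then have "local_dirichlet_integral (l j) f \<le> hardy_norm_sq ?h"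
        using l'[OF j] by (intro local_dirichlet_integral_le_hardy_norm_sq holomorphic_intros gh)
      also have "\<dots> \<le> 4 ^ card ({1..n} - {j}) * hardy_norm_sq g"
        using l' gh by (intro hardy_norm_sq_mult_prod) auto
      also have "\<dots> \<le> 4 ^ n * hardy_norm_sq g"
        using j by (intro mult_right_mono power_increasing) auto
      finally show ?thesis .
    qed
    have "dirichlet_integral ?\<mu> f = (\<Sum>j=1..n. ennreal (\<alpha> j) * local_dirichlet_integral (l j) f)"
      by (rule dirichlet_integral_point_mass_sum[OF l fh])
    also have "\<dots> \<le> (\<Sum>j=1..n. ennreal (max 0 (\<alpha> j)) * (4 ^ n * hardy_norm_sq g))"
      using loc by (intro sum_mono mult_mono) (auto intro: ennreal_leI)
    also have "\<dots> = ennreal (\<Sum>j=1..n. max 0 (\<alpha> j) * 4 ^ n) * hardy_norm_sq g"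
      by (simp add: sum_distrib_right ennreal_mult' mult.assoc flip: sum_ennreal ennreal_power ennreal_numeral)
    finally have df: "dirichlet_integral ?\<mu> f \<le> ennreal (\<Sum>j=1..n. max 0 (\<alpha> j) * 4 ^ n) * hardy_norm_sq g" .
    also have "\<dots> < \<infinity>"
      using gfin by (simp add: ennreal_mult_less_top)
    finally have "f \<in> dirichlet_space ?\<mu>"
      using fh by (simp add: dirichlet_space_def)
    from C(2)[OF this]
    have "(\<integral>\<^sup>+z. ennreal ((cmod (f z))\<^sup>2) \<partial>\<nu>) \<le> ennreal C * dirichlet_norm_sq ?\<mu> f" .
    also have "\<dots> \<le> ennreal C * (4 ^ n * hardy_norm_sq g + ennreal (\<Sum>j=1..n. max 0 (\<alpha> j) * 4 ^ n) * hardy_norm_sq g)"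
      unfolding dirichlet_norm_sq_def by (intro mult_left_mono add_mono hf df) simp
    also have "4 ^ n * hardy_norm_sq g + ennreal (\<Sum>j=1..n. max 0 (\<alpha> j) * 4 ^ n) * hardy_norm_sq g
        = ennreal B * hardy_norm_sq g"
    proof -
      have "ennreal B = ennreal (4 ^ n) + ennreal (\<Sum>j=1..n. max 0 (\<alpha> j) * 4 ^ n)"
        unfolding B_def by (rule ennreal_plus) (auto intro!: sum_nonneg)
      moreover have "ennreal (4 ^ n) = 4 ^ n"
        by (simp flip: ennreal_power)
      ultimately show ?thesis
        by (simp only: distrib_right)
    qed
    also have "ennreal C * (ennreal B * hardy_norm_sq g) = ennreal (C * B) * hardy_norm_sq g"
      using C(1) by (simp add: ennreal_mult' mult.assoc)
    finally show ?thesis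
      unfolding nn_integral_density_prod[OF \<nu> gh] f_def .
  qed
  show ?thesis
    unfolding carleson_measure_def using bound C(1) B by (intro exI[of _ "C * B"]) auto
qed

text \<open>Split f = p g + r. The Hardy condition controls p g in L^2(\<nu>), and \<open>r\<close>
  is bounded, so finiteness of \<nu> controls the rest.\<close>

lemma carleson_dirichlet_of_hardy:
  assumes n: "n \<ge> 1" and l: "\<And>j. j \<in> {1..n} \<Longrightarrow> l j \<in> sphere 0 1" and inj: "inj_on l {1..n}"
    and \<alpha>: "\<And>j. j \<in> {1..n} \<Longrightarrow> \<alpha> j > 0"
    and \<nu>: "sets \<nu> = sets disc_borel" and fin: "finite_measure \<nu>"
    and C: "carleson_measure hardy_space hardy_norm_sq
      (density \<nu> (\<lambda>z. ennreal (\<Prod>j=1..n. (cmod (z - l j))\<^sup>2)))"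
  shows "carleson_measure (dirichlet_space (point_mass_sum n \<alpha> l)) (dirichlet_norm_sq (point_mass_sum n \<alpha> l)) \<nu>"
proof -
  define J where "J = {1..n}"
  have J: "finite J" "J \<noteq> {}" using n by (auto simp: J_def)
  let ?\<mu> = "point_mass_sum n \<alpha> l"
  let ?P = "\<lambda>z. \<Prod>j\<in>J. z - l j"
  interpret finite_measure \<nu> by (rule fin)
  have space: "space \<nu> = ball 0 1"
    using sets_eq_imp_space_eq[OF \<nu>] by (simp add: disc_borel_def space_restrict_space)
  from C obtain C where C: "C > 0" "\<And>g. g \<in> hardy_space \<Longrightarrow>
      (\<integral>\<^sup>+z. ennreal ((cmod (g z))\<^sup>2) \<partial>density \<nu> (\<lambda>z. ennreal (\<Prod>j\<in>J. (cmod (z - l j))\<^sup>2))) \<le> ennreal C * hardy_norm_sq g"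
    unfolding carleson_measure_def J_def by blast
  have l': "cmod (l j) = 1" if "j \<in> J" for j
    using l that by (simp add: J_def)
  have \<alpha>': "\<alpha> j > 0" if "j \<in> J" for j
    using \<alpha> that by (simp add: J_def)
  have zl: "z \<notin> l ` J" if "z \<in> ball 0 1" for z
    using that l' by auto
  obtain w where w: "\<And>z. z \<notin> l ` J \<Longrightarrow> 1 / ?P z = (\<Sum>j\<in>J. w j / (z - l j))"
    using partial_fraction_decomposition[OF J inj[folded J_def]] by metis
  \<comment> \<open>\<open>K\<close> bounds the squared Hardy norm of \<open>g\<close> by the
    squared Dirichlet norm E of \<open>f\<close>, using that the squared norm of each quotient h_j
    is at most E/\<alpha>_j.\<close>
  define K where "K = real (card J) * (\<Sum>j\<in>J. (cmod (w j))\<^sup>2 * (1 / \<alpha> j))"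
  \<comment> \<open>\<open>L\<close> bounds |r|^2 by E on the disc: 4^n comes from |z - l_i| \<le>
    2, and 2 + 2/\<alpha>_j from the bound on |\<beta>_j|^2.\<close>
  define L where "L = real (card J) * (\<Sum>j\<in>J. (cmod (w j))\<^sup>2 * 4 ^ n * (2 + 2 / \<alpha> j))"
  \<comment> \<open>The factors 2 come from |a + b|^2 \<le> 2 |a|^2 + 2 |b|^2.\<close>
  define B where "B = 2 * (C * K) + 2 * (L * measure \<nu> (space \<nu>))"
  have KL: "0 \<le> K" "0 \<le> L"
    unfolding K_def L_def using \<alpha>' by (auto intro!: mult_nonneg_nonneg sum_nonneg add_nonneg_nonneg simp: less_imp_le)
  have "(\<integral>\<^sup>+z. ennreal ((cmod (f z))\<^sup>2) \<partial>\<nu>) \<le> ennreal B * dirichlet_norm_sq ?\<mu> f"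
    if f: "f \<in> dirichlet_space ?\<mu>" for f
  proof -
    define E where "E = dirichlet_norm_sq ?\<mu> f"
    have fh: "f holomorphic_on ball 0 1" and dfin: "dirichlet_integral ?\<mu> f < \<infinity>"
      using f by (auto simp: dirichlet_space_def)
    have deq: "dirichlet_integral ?\<mu> f = (\<Sum>j\<in>J. ennreal (\<alpha> j) * local_dirichlet_integral (l j) f)"
      unfolding J_def by (rule dirichlet_integral_point_mass_sum[OF l fh])
    have \<alpha>loc: "ennreal (\<alpha> j) * local_dirichlet_integral (l j) f \<le> dirichlet_integral ?\<mu> f" if "j \<in> J" for j
      unfolding deq using J(1) that by (intro member_le_sum) auto
    have loc: "local_dirichlet_integral (l j) f \<le> ennreal (1 / \<alpha> j) * E" if j: "j \<in> J" for j
    proof -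
      have "local_dirichlet_integral (l j) f = ennreal (1 / \<alpha> j) * (ennreal (\<alpha> j) * local_dirichlet_integral (l j) f)"
        using \<alpha>'[OF j] by (simp add: mult.assoc[symmetric] flip: ennreal_mult')
      also have "\<dots> \<le> ennreal (1 / \<alpha> j) * E"
        unfolding E_def dirichlet_norm_sq_def
        by (intro mult_left_mono add_increasing \<alpha>loc j) auto
      finally show ?thesis .
    qed
    \<comment> \<open>Positive weights are what passes finiteness from the weighted sum to each
      local integral.\<close>
    have locfin: "local_dirichlet_integral (l j) f < \<infinity>" if j: "j \<in> J" for j
    proof -
      have "ennreal (\<alpha> j) * local_dirichlet_integral (l j) f < \<infinity>"
        using \<alpha>loc[OF j] dfin by (rule le_less_trans)
      then show ?thesis
        using \<alpha>'[OF j] by (auto simp: ennreal_mult_less_top)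
    qed
    have "\<exists>\<beta> h. h holomorphic_on ball 0 1 \<and> (\<forall>z\<in>ball 0 1. f z = \<beta> + (z - l j) * h z)
        \<and> hardy_norm_sq h \<le> local_dirichlet_integral (l j) f
        \<and> ennreal ((cmod \<beta>)\<^sup>2) \<le> 2 * hardy_norm_sq f + 2 * hardy_norm_sq h" if j: "j \<in> J" for j
      using local_dirichlet_decomposition[OF l'[OF j] fh locfin[OF j]] by metis
    then obtain \<beta> h where hh: "\<And>j. j \<in> J \<Longrightarrow> h j holomorphic_on ball 0 1"
      and fb: "\<And>j z. j \<in> J \<Longrightarrow> z \<in> ball 0 1 \<Longrightarrow> f z = \<beta> j + (z - l j) * h j z"
      and hn: "\<And>j. j \<in> J \<Longrightarrow> hardy_norm_sq (h j) \<le> local_dirichlet_integral (l j) f"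
      and \<beta>n: "\<And>j. j \<in> J \<Longrightarrow> ennreal ((cmod (\<beta> j))\<^sup>2) \<le> 2 * hardy_norm_sq f + 2 * hardy_norm_sq (h j)"
      by metis
    define g where "g = (\<lambda>z. \<Sum>j\<in>J. w j * h j z)"
    define r where "r = (\<lambda>z. \<Sum>j\<in>J. w j * (\<beta> j * (\<Prod>i\<in>J - {j}. z - l i)))"
    have gh: "g holomorphic_on ball 0 1"
      unfolding g_def by (intro holomorphic_intros hh)
    \<comment> \<open>Multiply the partial fractions of 1/p by p f and insert f = \<beta>_j + (z -
      l_j) h_j in the j-th term: the h_j assemble to p g, the \<beta>_j to \<open>r\<close>.\<close>
    have split: "f z = ?P z * g z + r z" if z: "z \<in> ball 0 1" for z
    proof -
      have nz: "z - l j \<noteq> 0" if "j \<in> J" for j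
        using zl[OF z] that by auto
      have "?P z * (w j * h j z) + w j * (\<beta> j * (\<Prod>i\<in>J - {j}. z - l i)) = ?P z * f z * (w j / (z - l j))"
        if j: "j \<in> J" for j
        unfolding prod.remove[OF J(1) j] fb[OF j z] using nz[OF j] by (simp add: field_simps)
      then have "?P z * g z + r z = ?P z * f z * (\<Sum>j\<in>J. w j / (z - l j))"
        by (simp add: g_def r_def sum_distrib_left flip: sum.distrib)
      also have "\<dots> = f z"
        using w[OF zl[OF z]] nz J(1) by (simp flip: w[OF zl[OF z]])
      finally show ?thesis ..
    qed
    have gn: "hardy_norm_sq g \<le> ennreal (real (card J)) * (\<Sum>j\<in>J. ennreal ((cmod (w j))\<^sup>2) * hardy_norm_sq (h j))"
      unfolding g_def by (rule hardy_norm_sq_sum[OF hh])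
    also have "\<dots> < \<infinity>"
      using le_less_trans[OF hn locfin] J(1) by (auto simp: ennreal_mult_less_top)
    finally have gH: "g \<in> hardy_space"
      using gh by (simp add: hardy_space_def)
    note gn
    also have "ennreal (real (card J)) * (\<Sum>j\<in>J. ennreal ((cmod (w j))\<^sup>2) * hardy_norm_sq (h j))
        \<le> ennreal (real (card J)) * (\<Sum>j\<in>J. ennreal ((cmod (w j))\<^sup>2) * (ennreal (1 / \<alpha> j) * E))"
      using order_trans[OF hn loc] by (intro mult_left_mono sum_mono) auto
    also have "\<dots> = ennreal K * E"
    proof -
      have "(\<Sum>j\<in>J. ennreal ((cmod (w j))\<^sup>2 * (1 / \<alpha> j))) = ennreal (\<Sum>j\<in>J. (cmod (w j))\<^sup>2 * (1 / \<alpha> j))"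
        using \<alpha>' by (intro sum_ennreal mult_nonneg_nonneg) (auto simp: less_imp_le)
      then have "ennreal K = ennreal (real (card J)) * (\<Sum>j\<in>J. ennreal ((cmod (w j))\<^sup>2 * (1 / \<alpha> j)))"
        unfolding K_def by (simp only: ennreal_mult' of_nat_0_le_iff)
      also have "\<dots> = ennreal (real (card J)) * (\<Sum>j\<in>J. ennreal ((cmod (w j))\<^sup>2) * ennreal (1 / \<alpha> j))"
        by (simp only: ennreal_mult' zero_le_power2)
      finally have "ennreal K = ennreal (real (card J)) * (\<Sum>j\<in>J. ennreal ((cmod (w j))\<^sup>2) * ennreal (1 / \<alpha> j))" .
      then show ?thesis by (simp add: sum_distrib_right mult.assoc)
    qed
    finally have gK: "hardy_norm_sq g \<le> ennreal K * E" .
    have rL: "ennreal ((cmod (r z))\<^sup>2) \<le> ennreal L * E" if z: "z \<in> ball 0 1" for z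
    proof -
      have P: "(cmod (\<beta> j * (\<Prod>i\<in>J - {j}. z - l i)))\<^sup>2 \<le> 4 ^ n * (cmod (\<beta> j))\<^sup>2" if j: "j \<in> J" for j
      proof -
        have "cmod (z - l i) \<le> 2" if "i \<in> J" for i
          using norm_triangle_ineq4[of z "l i"] l'[OF that] z by simp
        then have "(\<Prod>i\<in>J - {j}. cmod (z - l i)) \<le> (\<Prod>i\<in>J - {j}. 2)"
          by (intro prod_mono) auto
        \<comment> \<open>Only n - 1 factors remain; the exponent is rounded up.\<close>
        also have "\<dots> \<le> 2 ^ n"
          using j by (simp add: J_def power_increasing)
        finally have "(cmod (\<Prod>i\<in>J - {j}. z - l i))\<^sup>2 \<le> (2 ^ n)\<^sup>2"
          by (intro power_mono) (auto simp: prod_norm)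
        also have "\<dots> = (4::real) ^ n"
          by (simp add: power2_eq_square flip: power_mult_distrib)
        finally have "(cmod (\<Prod>i\<in>J - {j}. z - l i))\<^sup>2 * (cmod (\<beta> j))\<^sup>2 \<le> 4 ^ n * (cmod (\<beta> j))\<^sup>2"
          by (rule mult_right_mono) simp
        then show ?thesis
          by (simp add: norm_mult power_mult_distrib mult.commute)
      qed
      have \<beta>E: "ennreal ((cmod (\<beta> j))\<^sup>2) \<le> ennreal (2 + 2 / \<alpha> j) * E" if j: "j \<in> J" for j
      proof -
        have "ennreal ((cmod (\<beta> j))\<^sup>2) \<le> 2 * E + 2 * (ennreal (1 / \<alpha> j) * E)"
          using order_trans[OF hn[OF j] loc[OF j]]
          by (intro order_trans[OF \<beta>n[OF j]] add_mono mult_left_mono) (auto simp: E_def dirichlet_norm_sq_def)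
        also have "\<dots> = (2 + 2 * ennreal (1 / \<alpha> j)) * E"
          by (simp add: distrib_right mult.assoc)
        also have "2 + 2 * ennreal (1 / \<alpha> j) = ennreal (2 + 2 / \<alpha> j)"
          using \<alpha>'[OF j] by (simp add: ennreal_plus less_imp_le ennreal_mult'[of 2 "1 / \<alpha> j", simplified])
        finally show ?thesis .
      qed
      have "(cmod (r z))\<^sup>2 \<le> real (card J) * (\<Sum>j\<in>J. (cmod (w j))\<^sup>2 * (cmod (\<beta> j * (\<Prod>i\<in>J - {j}. z - l i)))\<^sup>2)"
        unfolding r_def by (rule norm_sum_mult_sq_le)
      also have "\<dots> \<le> real (card J) * (\<Sum>j\<in>J. (cmod (w j))\<^sup>2 * 4 ^ n * (cmod (\<beta> j))\<^sup>2)"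
        using P by (intro mult_left_mono sum_mono) (auto simp: mult.assoc intro: mult_left_mono)
      finally have "ennreal ((cmod (r z))\<^sup>2)
          \<le> ennreal (real (card J) * (\<Sum>j\<in>J. (cmod (w j))\<^sup>2 * 4 ^ n * (cmod (\<beta> j))\<^sup>2))"
        by (rule ennreal_leI)
      also have "\<dots> = ennreal (real (card J)) * (\<Sum>j\<in>J. ennreal ((cmod (w j))\<^sup>2 * 4 ^ n) * ennreal ((cmod (\<beta> j))\<^sup>2))"
        by (subst ennreal_mult') (auto simp: ennreal_mult' simp flip: sum_ennreal)
      also have "\<dots> \<le> ennreal (real (card J)) * (\<Sum>j\<in>J. ennreal ((cmod (w j))\<^sup>2 * 4 ^ n) * (ennreal (2 + 2 / \<alpha> j) * E))"
        using \<beta>E by (intro mult_left_mono sum_mono) auto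
      also have "\<dots> = ennreal L * E"
      proof -
        have "ennreal L = ennreal (real (card J)) * (\<Sum>j\<in>J. ennreal ((cmod (w j))\<^sup>2 * 4 ^ n) * ennreal (2 + 2 / \<alpha> j))"
        proof -
          have "ennreal ((cmod (w j))\<^sup>2 * 4 ^ n) * ennreal (2 + 2 / \<alpha> j) = ennreal ((cmod (w j))\<^sup>2 * 4 ^ n * (2 + 2 / \<alpha> j))"
            for j by (rule ennreal_mult'[symmetric]) simp
          moreover have "(\<Sum>j\<in>J. ennreal ((cmod (w j))\<^sup>2 * 4 ^ n * (2 + 2 / \<alpha> j)))
              = ennreal (\<Sum>j\<in>J. (cmod (w j))\<^sup>2 * 4 ^ n * (2 + 2 / \<alpha> j))"
            using \<alpha>' by (intro sum_ennreal mult_nonneg_nonneg add_nonneg_nonneg) (auto simp: less_imp_le)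
          ultimately show ?thesis
            unfolding L_def by (simp add: ennreal_mult')
        qed
        then show ?thesis by (simp add: sum_distrib_right mult.assoc)
      qed
      finally show ?thesis .
    qed
    have PGm: "(\<lambda>z. ennreal ((cmod (?P z * g z))\<^sup>2)) \<in> borel_measurable \<nu>"
      by (intro borel_measurable_holomorphic_cmod_sq[OF \<nu>] holomorphic_intros gh)
    have "(\<integral>\<^sup>+z. ennreal ((cmod (f z))\<^sup>2) \<partial>\<nu>)
        \<le> (\<integral>\<^sup>+z. 2 * ennreal ((cmod (?P z * g z))\<^sup>2) + 2 * (ennreal L * E) \<partial>\<nu>)"
    proof (rule nn_integral_mono)
      fix z assume "z \<in> space \<nu>"
      then have z: "z \<in> ball 0 1" by (simp add: space)
      have "ennreal ((cmod (f z))\<^sup>2) \<le> ennreal (2 * (cmod (?P z * g z))\<^sup>2 + 2 * (cmod (r z))\<^sup>2)"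
        unfolding split[OF z] by (intro ennreal_leI norm_add_sq_le)
      also have "\<dots> = 2 * ennreal ((cmod (?P z * g z))\<^sup>2) + 2 * ennreal ((cmod (r z))\<^sup>2)"
        by (simp add: ennreal_plus ennreal_mult')
      also have "\<dots> \<le> 2 * ennreal ((cmod (?P z * g z))\<^sup>2) + 2 * (ennreal L * E)"
        by (intro add_mono mult_left_mono rL z) auto
      finally show "ennreal ((cmod (f z))\<^sup>2) \<le> 2 * ennreal ((cmod (?P z * g z))\<^sup>2) + 2 * (ennreal L * E)" .
    qed
    also have "\<dots> = 2 * (\<integral>\<^sup>+z. ennreal ((cmod (?P z * g z))\<^sup>2) \<partial>\<nu>) + 2 * (ennreal L * E) * emeasure \<nu> (space \<nu>)"
      using PGm by (subst nn_integral_add) (auto simp: nn_integral_cmult)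
    also have "\<dots> \<le> 2 * (ennreal C * (ennreal K * E)) + 2 * (ennreal L * E) * emeasure \<nu> (space \<nu>)"
    proof -
      have "(\<integral>\<^sup>+z. ennreal ((cmod (?P z * g z))\<^sup>2) \<partial>\<nu>) \<le> ennreal C * hardy_norm_sq g"
        using C(2)[OF gH] unfolding nn_integral_density_prod[OF \<nu> gh] .
      also have "\<dots> \<le> ennreal C * (ennreal K * E)"
        by (intro mult_left_mono gK) simp
      finally show ?thesis by (intro add_mono mult_left_mono order_refl) simp_all
    qed
    also have "\<dots> = ennreal B * E"
    proof -
      have "ennreal B = 2 * (ennreal C * ennreal K) + 2 * (ennreal L * emeasure \<nu> (space \<nu>))"
        unfolding B_def emeasure_eq_measure using C(1) KL by (simp add: ennreal_mult' less_imp_le)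
      then show ?thesis by (simp add: distrib_left mult_ac)
    qed
    finally show ?thesis by (simp add: E_def)
  qed
  moreover have "0 \<le> B"
    unfolding B_def using C(1) KL by simp
  \<comment> \<open>\<open>B\<close> may be 0, whereas a Carleson constant has to be positive; hence
    B + 1.\<close>
  ultimately have "(\<integral>\<^sup>+z. ennreal ((cmod (f z))\<^sup>2) \<partial>\<nu>) \<le> ennreal (B + 1) * dirichlet_norm_sq ?\<mu> f"
    if "f \<in> dirichlet_space ?\<mu>" for f
    using that by (meson order_trans mult_right_mono ennreal_leI less_add_one less_imp_le zero_le)
  then show ?thesis
    unfolding carleson_measure_def using \<open>0 \<le> B\<close> by (intro exI[of _ "B + 1"]) auto
qed

theorem theorem4p1:
  fixes n :: nat and l :: "nat \<Rightarrow> complex" and \<alpha> :: "nat \<Rightarrow> real" and \<mu> \<nu> :: "complex measure"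
  assumes "n \<ge> 1"
    and "\<And>j. j \<in> {1..n} \<Longrightarrow> l j \<in> sphere 0 1"
    and "inj_on l {1..n}"
    and "\<And>j. j \<in> {1..n} \<Longrightarrow> \<alpha> j > 0"
    and "\<mu> = point_mass_sum n \<alpha> l"
    and "sets \<nu> = sets disc_borel"
    and "finite_measure \<nu>"
  shows "carleson_measure (dirichlet_space \<mu>) (dirichlet_norm_sq \<mu>) \<nu> \<longleftrightarrow>
    carleson_measure hardy_space hardy_norm_sq
      (density \<nu> (\<lambda>z. ennreal (\<Prod>j=1..n. (cmod (z - l j))\<^sup>2)))"
proof
  assume "carleson_measure (dirichlet_space \<mu>) (dirichlet_norm_sq \<mu>) \<nu>"
  then show "carleson_measure hardy_space hardy_norm_sq
      (density \<nu> (\<lambda>z. ennreal (\<Prod>j=1..n. (cmod (z - l j))\<^sup>2)))"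
    unfolding assms(5) by (rule carleson_hardy_of_dirichlet[rotated 2]) (use assms in auto)
next
  assume "carleson_measure hardy_space hardy_norm_sq
      (density \<nu> (\<lambda>z. ennreal (\<Prod>j=1..n. (cmod (z - l j))\<^sup>2)))"
  then show "carleson_measure (dirichlet_space \<mu>) (dirichlet_norm_sq \<mu>) \<nu>"
    unfolding assms(5) by (rule carleson_dirichlet_of_hardy[rotated 6]) (use assms in auto)
qed

end
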